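(* Let $d\ge1$ and let $\Omega\subset\mathbb{R}^d$ be an open bounded set with smooth boundary. Let $(u,\gamma)$ be a positive smooth solution of $$\partial_t u=\Delta\Big(\frac{u^n}{\gamma}\Big),\qquad \partial_t\gamma=-\gamma+u^m\qquad\text{in }\Omega\times(0,\infty),$$ with $\frac{\partial u}{\partial\nu}=\frac{\partial\gamma}{\partial\nu}=0$ on $\partial\Omega$ and initial data $(u_0,\gamma_0)\in L^\infty(\Omega)\times L^\infty(\Omega)$ satisfying $\frac{\partial u_0}{\partial\nu}=\frac{\partial\gamma_0}{\partial\nu}=0$ on $\partial\Omega$. Then, for $n,m>0$, $(u,\gamma)$ satisfies $$\frac{d}{dt}\int_\Omega F(u,\gamma)\,d\mathbf{x}+(n+1)\int_\Omega\Big|\nabla\frac{u^n}{\gamma}\Big|^2d\mathbf{x}+\int_\Omega\frac{1}{\gamma^2}\Big((u^m)^{\frac{n+1}{m}}-\gamma^{\frac{n+1}{m}}\Big)(u^m-\gamma)\,d\mathbf{x}=0,$$ where $$F(u,\gamma):=\frac{u^{n+1}}{\gamma}+\frac{m}{n-m+1}\,\gamma^{\frac{n-m+1}{m}}$$ is a convex functional near the equilibrium for $n>m$, and is additionally globally convex for $n>1$, $n+1>2m$.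
   Context: $\nu$ denotes the outward unit normal on $\partial\Omega$. A positive smooth solution is a pair of positive smooth functions satisfying the equations, boundary conditions and initial conditions. The equilibrium is the constant state $(a,a^m)$, $a>0$.
   Formalization: The case m = n+1 is excluded by the added assumption n − m + 1 ≠ 0, because there the coefficient m/(n−m+1) in F is a division by zero and F is undefined; the convexity claims are not affected. *)

theory Defs
  imports "HOL-Analysis.Analysis"
begin

section \<open>Differential operators and smoothness\<close>

definition gradient :: "('a::euclidean_space \<Rightarrow> real) \<Rightarrow> 'a \<Rightarrow> 'a" where
  "gradient f x = (\<Sum>i\<in>Basis. frechet_derivative f (at x) i *\<^sub>R i)"

definition laplacian :: "('a::euclidean_space \<Rightarrow> real) \<Rightarrow> 'a \<Rightarrow> real" where
  "laplacian f x =
     (\<Sum>i\<in>Basis. frechet_derivative (\<lambda>y. frechet_derivative f (at y) i) (at x) i)"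

text \<open>Only meaningful for open \<open>S\<close>: \<open>k\<close> times continuously differentiable on \<open>S\<close>.\<close>

primrec Ck_on :: "nat \<Rightarrow> 'a::euclidean_space set \<Rightarrow> ('a \<Rightarrow> real) \<Rightarrow> bool" where
  "Ck_on 0 S f \<longleftrightarrow> continuous_on S f"
| "Ck_on (Suc k) S f \<longleftrightarrow>
     (\<forall>x\<in>S. f differentiable (at x)) \<and>
     (\<forall>v. Ck_on k S (\<lambda>x. frechet_derivative f (at x) v))"

text \<open>
  Smoothness on an arbitrary set means that \<open>f\<close> locally extends to a \<open>C\<^sup>\<infinity>\<close> function on an
  open set. For open \<open>S\<close> this is ordinary smoothness; for the closure of a domain it is
  smoothness up to the boundary.
\<close>

definition smooth_on :: "'a::euclidean_space set \<Rightarrow> ('a \<Rightarrow> real) \<Rightarrow> bool" where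
  "smooth_on S f \<longleftrightarrow>
     (\<forall>x\<in>S. \<exists>U g. open U \<and> x \<in> U \<and> (\<forall>k. Ck_on k U g) \<and> (\<forall>y\<in>U \<inter> S. g y = f y))"


section \<open>Smooth boundaries and normal derivatives\<close>

text \<open>
  The condition \<open>U \<inter> \<Omega> = {x\<in>U. \<phi> x < 0}\<close> forces \<open>\<Omega>\<close> to lie locally on one side of its
  boundary, and makes \<open>\<nabla>\<phi>\<close> point out of \<open>\<Omega>\<close>.
\<close>

definition local_defining_function ::
    "'a::euclidean_space set \<Rightarrow> 'a \<Rightarrow> 'a set \<Rightarrow> ('a \<Rightarrow> real) \<Rightarrow> bool" where
  "local_defining_function \<Omega> p U \<phi> \<longleftrightarrow>
     open U \<and> p \<in> U \<and> smooth_on U \<phi> \<and> (\<forall>x\<in>U. gradient \<phi> x \<noteq> 0) \<and>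
     U \<inter> \<Omega> = {x\<in>U. \<phi> x < 0} \<and> U \<inter> frontier \<Omega> = {x\<in>U. \<phi> x = 0}"

definition smooth_boundary :: "'a::euclidean_space set \<Rightarrow> bool" where
  "smooth_boundary \<Omega> \<longleftrightarrow> (\<forall>p\<in>frontier \<Omega>. \<exists>U \<phi>. local_defining_function \<Omega> p U \<phi>)"

definition outward_unit_normal :: "'a::euclidean_space set \<Rightarrow> 'a \<Rightarrow> 'a \<Rightarrow> bool" where
  "outward_unit_normal \<Omega> p \<nu> \<longleftrightarrow>
     p \<in> frontier \<Omega> \<and>
     (\<exists>U \<phi>. local_defining_function \<Omega> p U \<phi> \<and> \<nu> = gradient \<phi> p /\<^sub>R norm (gradient \<phi> p))"

text \<open>
  The normal derivative at a boundary point is taken from inside the domain: for \<open>s < 0\<close> close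
  to \<open>0\<close> the point \<open>p + s \<nu>\<close> lies in \<open>\<Omega>\<close>. Values of \<open>f\<close> outside the closure are irrelevant.
\<close>

definition zero_normal_derivative :: "'a::euclidean_space set \<Rightarrow> ('a \<Rightarrow> real) \<Rightarrow> bool" where
  "zero_normal_derivative \<Omega> f \<longleftrightarrow>
     (\<forall>p\<in>frontier \<Omega>. \<forall>\<nu>. outward_unit_normal \<Omega> p \<nu> \<longrightarrow>
        ((\<lambda>s. f (p + s *\<^sub>R \<nu>)) has_real_derivative 0) (at_left 0))"


section \<open>The system and its Lyapunov density\<close>

definition bounded_measurable_on :: "'a::euclidean_space set \<Rightarrow> ('a \<Rightarrow> real) \<Rightarrow> bool" where
  "bounded_measurable_on \<Omega> f \<longleftrightarrow>
     f \<in> borel_measurable (lebesgue_on \<Omega>) \<and> (\<exists>C. AE x in lebesgue_on \<Omega>. \<bar>f x\<bar> \<le> C)"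

text \<open>
  Functions of space and time are written \<open>u x t\<close>. As the initial data are only bounded and
  measurable, smoothness is required for positive times and the initial data are attained as
  almost everywhere limits.
\<close>

definition positive_smooth_solution ::
    "real \<Rightarrow> real \<Rightarrow> 'a::euclidean_space set \<Rightarrow> ('a \<Rightarrow> real) \<Rightarrow> ('a \<Rightarrow> real) \<Rightarrow>
     ('a \<Rightarrow> real \<Rightarrow> real) \<Rightarrow> ('a \<Rightarrow> real \<Rightarrow> real) \<Rightarrow> bool" where
  "positive_smooth_solution n m \<Omega> u0 \<gamma>0 u \<gamma> \<longleftrightarrow>
     smooth_on (closure \<Omega> \<times> {0<..}) (\<lambda>(x, t). u x t) \<and>
     smooth_on (closure \<Omega> \<times> {0<..}) (\<lambda>(x, t). \<gamma> x t) \<and>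
     (\<forall>x\<in>closure \<Omega>. \<forall>t>0. 0 < u x t \<and> 0 < \<gamma> x t) \<and>
     (\<forall>x\<in>\<Omega>. \<forall>t>0.
        ((\<lambda>s. u x s) has_real_derivative laplacian (\<lambda>y. u y t powr n / \<gamma> y t) x) (at t) \<and>
        ((\<lambda>s. \<gamma> x s) has_real_derivative - \<gamma> x t + u x t powr m) (at t)) \<and>
     (\<forall>t>0. zero_normal_derivative \<Omega> (\<lambda>x. u x t) \<and> zero_normal_derivative \<Omega> (\<lambda>x. \<gamma> x t)) \<and>
     (AE x in lebesgue_on \<Omega>.
        ((\<lambda>t. u x t) \<longlongrightarrow> u0 x) (at_right 0) \<and> ((\<lambda>t. \<gamma> x t) \<longlongrightarrow> \<gamma>0 x) (at_right 0))"

text \<open>Division by zero makes this the intended function only for \<open>n - m + 1 \<noteq> 0\<close>.\<close>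

definition F :: "real \<Rightarrow> real \<Rightarrow> real \<Rightarrow> real \<Rightarrow> real" where
  "F n m u \<gamma> = u powr (n + 1) / \<gamma> + m / (n - m + 1) * \<gamma> powr ((n - m + 1) / m)"

end

theory Submission
  imports Defs
begin

text \<open>
  Differentiating \<open>\<integral> F(u, \<gamma>)\<close> under the integral and inserting the equations gives
  \<open>(n + 1) \<integral> w \<Delta>w\<close> with \<open>w = u\<^sup>n / \<gamma>\<close>, minus the last integral of the identity, so all that is needed
  is \<open>\<integral> div (w \<nabla>w) = 0\<close>. As \<open>w \<nabla>w\<close> is tangential to the boundary, this requires no surface
  measure: localise with a partition of unity, cut off near the boundary by a function of the
  defining function \<open>\<phi>\<close>, and use that \<open>\<nabla>\<phi> \<cdot> (w \<nabla>w)\<close> is Lipschitz and zero on the boundary, hence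
  \<open>O(\<bar>\<phi>\<bar>)\<close>. Convexity is read off the Hessian of \<open>F\<close>, whose determinant at
  \<open>(a, a\<^sup>m)\<close> is a positive multiple of \<open>n - m\<close>.
\<close>

section \<open>Calculus of \<open>C\<^sup>k\<close> functions\<close>

text \<open>\<open>F\<close> is tuned to the system. Its derivative in u is (n + 1) u^n / \<gamma>,
  a multiple of the quantity under the Laplacian; its derivative in \<gamma> is -1/\<gamma>^2 times
  u^(n+1) - \<gamma>^((n+1)/m), which vanishes exactly where \<gamma> = u^m, the zero set of the
  second right-hand side. The coefficient m / (n - m + 1) undoes the exponent of the second term.
  The obstacle is the boundary. A solution is smooth there through unrelated local extensions,
  whereas the Neumann condition is a one-sided derivative along the normal; both have to meet in a
  statement about limits from inside. Cutting off a layer of width \<epsilon> costs a gradient of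
  size 1/\<epsilon>, whose integral over the layer does not tend to zero by itself; the linear decay
  of the normal component compensates it. A cutoff that is a function of \<phi> has its gradient
  parallel to that of \<phi>, so no other component of the field enters.\<close>

lemma frechet_derivative_eqI:
  "(f has_derivative f') (at x) \<Longrightarrow> frechet_derivative f (at x) v = f' v"
  by (metis frechet_derivative_at)

lemma frechet_derivative_cong_open:
  assumes "open S" "x \<in> S" "\<And>y. y \<in> S \<Longrightarrow> f y = g y"
  shows "frechet_derivative f (at x) = frechet_derivative g (at x)"
proof -
  have "(f has_derivative f') (at x) \<longleftrightarrow> (g has_derivative f') (at x)" for f'
    using assms has_derivative_transform_within_open[of _ _ x UNIV S] by metis
  then show ?thesis by (simp add: frechet_derivative_def)
qed

lemma differentiable_cong_open:
  assumes "open S" "x \<in> S" "\<And>y. y \<in> S \<Longrightarrow> f y = g y" "f differentiable (at x)"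
  shows "g differentiable (at x)"
  using assms has_derivative_transform_within_open[of _ _ x UNIV S]
  unfolding differentiable_def by metis

lemma Ck_on_cong:
  assumes "open S" "\<And>x. x \<in> S \<Longrightarrow> f x = g x" "Ck_on k S f"
  shows "Ck_on k S g"
  using assms(2,3)
proof (induction k arbitrary: f g)
  case 0
  have "continuous_on S f \<longleftrightarrow> continuous_on S g"
    by (rule continuous_on_cong[OF refl 0(1)])
  then show ?case using 0(2) by simp
next
  case (Suc k)
  have "g differentiable (at x)" if "x \<in> S" for x
    by (rule differentiable_cong_open[OF assms(1) that Suc.prems(1)]) (use Suc.prems(2) that in auto)
  moreover have "Ck_on k S (\<lambda>x. frechet_derivative g (at x) v)" for v
  proof (rule Suc.IH)
    show "Ck_on k S (\<lambda>x. frechet_derivative f (at x) v)" using Suc.prems(2) by simp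
    show "frechet_derivative f (at x) v = frechet_derivative g (at x) v" if "x \<in> S" for x
      by (rule fun_cong[OF frechet_derivative_cong_open[OF assms(1) that Suc.prems(1)]])
  qed
  ultimately show ?case by simp
qed

lemma Ck_on_subset: "Ck_on k S f \<Longrightarrow> T \<subseteq> S \<Longrightarrow> Ck_on k T f"
  by (induction k arbitrary: f) (auto intro: continuous_on_subset)

lemma Ck_on_Suc_imp: "Ck_on (Suc k) S f \<Longrightarrow> Ck_on k S f"
proof (induction k arbitrary: f)
  case 0
  then show ?case
    by (auto intro!: differentiable_imp_continuous_on differentiable_at_imp_differentiable_on)
next
  case (Suc k)
  then show ?case using Ck_on.simps(2) by blast
qed

lemma Ck_on_le: "Ck_on l S f \<Longrightarrow> k \<le> l \<Longrightarrow> Ck_on k S f"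
proof (induction l)
  case (Suc l)
  then show ?case using Ck_on_Suc_imp le_Suc_eq by metis
qed simp

lemma Ck_on_imp_continuous_on: "Ck_on k S f \<Longrightarrow> continuous_on S f"
  using Ck_on_le[of k S f 0] by simp

lemma Ck_on_imp_has_derivative:
  "Ck_on (Suc k) S f \<Longrightarrow> x \<in> S \<Longrightarrow> (f has_derivative frechet_derivative f (at x)) (at x)"
  using frechet_derivative_works by auto

lemma Ck_on_partial: "Ck_on (Suc k) S f \<Longrightarrow> Ck_on k S (\<lambda>x. frechet_derivative f (at x) v)"
  by simp

text \<open>\<open>Ck_on\<close> recurses through \<open>frechet_derivative\<close>, which is
  awkward to compute with. Here any family \<open>f'\<close> of derivatives may stand in for it, so
  that each closure property below reduces to a derivative rule followed by the induction
  hypothesis.\<close>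

lemma Ck_on_SucI:
  assumes "open S" "\<And>x. x \<in> S \<Longrightarrow> (f has_derivative f' x) (at x)"
    "\<And>v. Ck_on k S (\<lambda>x. f' x v)"
  shows "Ck_on (Suc k) S f"
proof -
  have "frechet_derivative f (at x) = f' x" if "x \<in> S" for x
    using assms(2)[OF that] frechet_derivative_at by metis
  then have "Ck_on k S (\<lambda>x. frechet_derivative f (at x) v)" for v
    by (intro Ck_on_cong[OF assms(1) _ assms(3)[of v]]) simp
  then show ?thesis using differentiableI[OF assms(2)] by auto
qed

lemma Ck_on_const: "open S \<Longrightarrow> Ck_on k S (\<lambda>x. c)"
proof (induction k arbitrary: c)
  case (Suc k)
  then show ?case by (intro Ck_on_SucI[where f' = "\<lambda>x v. 0"]) auto
qed simp

lemma Ck_on_add: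
  assumes "open S" "Ck_on k S f" "Ck_on k S g"
  shows "Ck_on k S (\<lambda>x. f x + g x)"
  using assms(2,3)
proof (induction k arbitrary: f g)
  case 0
  then show ?case by (auto intro: continuous_intros)
next
  case (Suc k)
  note der = Suc.prems[THEN Ck_on_imp_has_derivative]
  show ?case
    by (rule Ck_on_SucI[OF assms(1)], rule has_derivative_add[OF der])
      (use Suc in auto)
qed

lemma Ck_on_mult:
  assumes "open S" "Ck_on k S f" "Ck_on k S g"
  shows "Ck_on k S (\<lambda>x. f x * g x)"
  using assms(2,3)
proof (induction k arbitrary: f g)
  case 0
  then show ?case by (auto intro: continuous_intros)
next
  case (Suc k)
  note der = Suc.prems[THEN Ck_on_imp_has_derivative]
  have "Ck_on k S (\<lambda>x. f x * frechet_derivative g (at x) v + frechet_derivative f (at x) v * g x)" for v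
    by (intro Ck_on_add[OF assms(1)] Suc.IH Ck_on_partial[OF Suc.prems(1)] Ck_on_partial[OF Suc.prems(2)]
        Ck_on_Suc_imp[OF Suc.prems(1)] Ck_on_Suc_imp[OF Suc.prems(2)])
  then show ?case
    by (intro Ck_on_SucI[OF assms(1), where f' = "\<lambda>x v. f x * frechet_derivative g (at x) v
          + frechet_derivative f (at x) v * g x"] has_derivative_mult[OF der])
qed

lemma Ck_on_sum:
  assumes "open S" "\<And>i. i \<in> I \<Longrightarrow> Ck_on k S (f i)"
  shows "Ck_on k S (\<lambda>x. \<Sum>i\<in>I. f i x)"
  using assms(2)
  by (induction I rule: infinite_finite_induct) (auto intro!: Ck_on_const Ck_on_add assms(1))

text \<open>Differentiation lowers the exponent and leaves the base alone, so the induction runs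
  over all exponents at once with \<open>f\<close> fixed.\<close>

lemma Ck_on_powr:
  assumes "open S" "Ck_on k S f" "\<And>x. x \<in> S \<Longrightarrow> 0 < f x"
  shows "Ck_on k S (\<lambda>x. f x powr a)"
  using assms(2)
proof (induction k arbitrary: a)
  case 0
  then show ?case using assms(3) by (auto intro!: continuous_intros simp: less_imp_neq[symmetric])
next
  case (Suc k)
  have "((\<lambda>x. f x powr a) has_derivative (\<lambda>v. a * f x powr (a - 1) * frechet_derivative f (at x) v)) (at x)"
    if "x \<in> S" for x
    using has_real_derivative_powr[OF assms(3)[OF that], of a]
      Ck_on_imp_has_derivative[OF Suc.prems that]
    unfolding has_field_derivative_def
    by (rule has_derivative_compose[rotated, of "\<lambda>x. x powr a", THEN has_derivative_eq_rhs]) auto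
  moreover have "Ck_on k S (\<lambda>x. a * f x powr (a - 1) * frechet_derivative f (at x) v)" for v
    by (intro Ck_on_mult[OF assms(1)] Ck_on_const[OF assms(1)] Suc.IH Ck_on_partial[OF Suc.prems]
        Ck_on_Suc_imp[OF Suc.prems])
  ultimately show ?case
    by (intro Ck_on_SucI[OF assms(1)])
qed

text \<open>Serves for outer functions that are only once continuously differentiable: the squared
  positive part and the cutoff made from it. Continuity of \<open>g'\<close> is asked on the range
  of \<open>f\<close> alone, since the cutoff is singular at 0.\<close>

lemma C1_on_compose:
  assumes "open S" "Ck_on 1 S f"
    and "\<And>x. x \<in> S \<Longrightarrow> (g has_real_derivative g' (f x)) (at (f x))"
    and "continuous_on (f ` S) g'"
  shows "Ck_on 1 S (\<lambda>x. g (f x))"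
proof -
  have "((\<lambda>x. g (f x)) has_derivative (\<lambda>v. g' (f x) * frechet_derivative f (at x) v)) (at x)"
    if "x \<in> S" for x
    using assms(3)[OF that] Ck_on_imp_has_derivative[OF assms(2)[unfolded One_nat_def] that]
    unfolding has_field_derivative_def
    by (rule has_derivative_compose[rotated, of g, THEN has_derivative_eq_rhs]) auto
  moreover have "continuous_on S f" using assms(2) by (rule Ck_on_imp_continuous_on)
  then have "continuous_on S (\<lambda>x. g' (f x))"
    using assms(4) continuous_on_compose2 by blast
  ultimately show ?thesis unfolding One_nat_def using assms(2)
    by (intro Ck_on_SucI[OF assms(1), where f' = "\<lambda>x v. g' (f x) * frechet_derivative f (at x) v"])
      (auto intro!: continuous_intros)
qed

text \<open>A derivative of the slice in direction \<open>v\<close> is a slice of the derivative of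
  \<open>g\<close> in direction \<open>(v, 0)\<close>, which is why \<open>g\<close> varies in the
  induction.\<close>

lemma Ck_on_slice:
  fixes g :: "'a::euclidean_space \<times> real \<Rightarrow> real"
  assumes "open U" "Ck_on k U g"
  shows "Ck_on k {x. (x, t) \<in> U} (\<lambda>x. g (x, t))"
proof -
  have op: "open {x. (x, t) \<in> U}"
    using open_vimage[OF assms(1), of "\<lambda>x. (x, t)"]
    by (simp add: vimage_def continuous_on_Pair)
  show ?thesis using assms(2)
  proof (induction k arbitrary: g)
    case 0
    then show ?case by (auto intro!: continuous_on_compose2[of U g] continuous_intros)
  next
    case (Suc k)
    have "((\<lambda>x. g (x, t)) has_derivative (\<lambda>v. frechet_derivative g (at (x, t)) (v, 0))) (at x)"
      if "(x, t) \<in> U" for x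
      using Ck_on_imp_has_derivative[OF Suc.prems that]
      by (rule has_derivative_compose[rotated]) (auto intro!: derivative_eq_intros)
    moreover have "Ck_on k {x. (x, t) \<in> U} (\<lambda>x. frechet_derivative g (at (x, t)) (v, 0))" for v
      by (rule Suc.IH[OF Ck_on_partial[OF Suc.prems]])
    ultimately show ?case
      by (intro Ck_on_SucI[OF op, where f' = "\<lambda>x v. frechet_derivative g (at (x, t)) (v, 0)"]) auto
  qed
qed

text \<open>Squaring the positive part removes its corner, at the price of a jump in the second
  derivative. The cutoffs and the bumps are built from this function.\<close>

lemma has_real_derivative_max_square:
  "((\<lambda>y::real. (max 0 y)\<^sup>2) has_real_derivative 2 * max 0 y) (at y)"
proof (cases y "0::real" rule: linorder_cases)
  case less
  show ?thesis
    by (rule DERIV_cong[OF has_field_derivative_transform_within_open[of "\<lambda>_. 0" 0 _ "{..<0}"]])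
      (use less in auto)
next
  case equal
  have "((\<lambda>h. (max 0 h)\<^sup>2 / h) \<longlongrightarrow> 0) (at (0::real))"
    by (rule Lim_null_comparison[of _ "\<lambda>h. \<bar>h\<bar>"])
      (auto intro!: always_eventually tendsto_eq_intros simp: max_def power2_eq_square)
  then show ?thesis using equal by (simp add: DERIV_def)
next
  case greater
  show ?thesis
    by (rule DERIV_cong[OF has_field_derivative_transform_within_open[of "\<lambda>y. y\<^sup>2" "2 * y" _ "{0<..}"]])
      (use greater in \<open>auto intro!: derivative_eq_intros\<close>)
qed

section \<open>Functions that extend to the closure\<close>

lemma Ck_on_local:
  assumes "open S" "\<And>x. x \<in> S \<Longrightarrow> \<exists>U. open U \<and> x \<in> U \<and> Ck_on k (U \<inter> S) f"
  shows "Ck_on k S f"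
  using assms(2)
proof (induction k arbitrary: f)
  case 0
  have "isCont f x" if x: "x \<in> S" for x
  proof -
    obtain U where U: "open U" "x \<in> U" "continuous_on (U \<inter> S) f" using 0[OF x] by auto
    moreover have "open (U \<inter> S)" using U assms(1) by auto
    ultimately show ?thesis using x continuous_on_eq_continuous_at by blast
  qed
  then show ?case by (simp add: continuous_at_imp_continuous_on)
next
  case (Suc k)
  have "f differentiable (at x)" if "x \<in> S" for x using Suc.prems[OF that] that by auto
  moreover have "Ck_on k S (\<lambda>x. frechet_derivative f (at x) v)" for v
  proof (rule Suc.IH)
    fix x assume "x \<in> S"
    from Suc.prems[OF this]
    show "\<exists>U. open U \<and> x \<in> U \<and> Ck_on k (U \<inter> S) (\<lambda>x. frechet_derivative f (at x) v)" by auto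
  qed
  ultimately show ?case by simp
qed

text \<open>
  An extension is required near every point of \<open>T\<close>, but it has to agree with \<open>f\<close> only on \<open>S\<close>. With
  \<open>S = \<Omega>\<close> and \<open>T = closure \<Omega>\<close> this ignores the values of \<open>f\<close> on the boundary, which are junk for the
  partial derivatives of a function that is only given on the closure.
\<close>

definition Ck_ext :: "nat \<Rightarrow> 'a::euclidean_space set \<Rightarrow> 'a set \<Rightarrow> ('a \<Rightarrow> real) \<Rightarrow> bool" where
  "Ck_ext k T S f \<longleftrightarrow>
     (\<forall>x\<in>T. \<exists>U g. open U \<and> x \<in> U \<and> Ck_on k U g \<and> (\<forall>y\<in>U \<inter> S. g y = f y))"

lemma Ck_extE:
  assumes "Ck_ext k T S f" "x \<in> T"
  obtains U g where "open U" "x \<in> U" "Ck_on k U g" "\<And>y. y \<in> U \<Longrightarrow> y \<in> S \<Longrightarrow> g y = f y"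
proof -
  from assms(1)[unfolded Ck_ext_def, rule_format, OF assms(2)] obtain U g
    where *: "open U" "x \<in> U" "Ck_on k U g" "\<forall>y\<in>U \<inter> S. g y = f y" by blast
  show ?thesis by (rule that[OF *(1-3)]) (use *(4) in blast)
qed

lemma Ck_ext_mono:
  assumes "Ck_ext k T S f" "k' \<le> k" "T' \<subseteq> T" "S' \<subseteq> S"
  shows "Ck_ext k' T' S' f"
  unfolding Ck_ext_def
proof
  fix x assume "x \<in> T'"
  then have "x \<in> T" using assms(3) by blast
  then obtain U g where "open U" "x \<in> U" "Ck_on k U g" "\<And>y. y \<in> U \<Longrightarrow> y \<in> S \<Longrightarrow> g y = f y"
    using Ck_extE[OF assms(1)] by blast
  then show "\<exists>U g. open U \<and> x \<in> U \<and> Ck_on k' U g \<and> (\<forall>y\<in>U \<inter> S'. g y = f y)"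
    using Ck_on_le[OF _ assms(2)] assms(4) by blast
qed

lemma Ck_ext_cong:
  assumes "Ck_ext k T S f" "\<And>x. x \<in> S \<Longrightarrow> f x = g x"
  shows "Ck_ext k T S g"
  using assms unfolding Ck_ext_def by (metis IntD2)

lemma Ck_on_imp_Ck_ext: "open U \<Longrightarrow> Ck_on k U f \<Longrightarrow> T \<subseteq> U \<Longrightarrow> Ck_ext k T S f"
  unfolding Ck_ext_def by blast

lemma Ck_ext_const: "Ck_ext k T S (\<lambda>x. c)"
  by (rule Ck_on_imp_Ck_ext[of UNIV]) (auto intro: Ck_on_const)

lemma Ck_ext_combine:
  fixes f g :: "'a::euclidean_space \<Rightarrow> real"
  assumes "Ck_ext k T S f" "Ck_ext k T S g"
    and "\<And>(U :: 'a set) f g. open U \<Longrightarrow> Ck_on k U f \<Longrightarrow> Ck_on k U g \<Longrightarrow> Ck_on k U (\<lambda>x. h (f x) (g x))"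
  shows "Ck_ext k T S (\<lambda>x. h (f x) (g x))"
  unfolding Ck_ext_def
proof
  fix x assume "x \<in> T"
  obtain U f' where f: "open U" "x \<in> U" "Ck_on k U f'" "\<And>y. y \<in> U \<Longrightarrow> y \<in> S \<Longrightarrow> f' y = f y"
    using Ck_extE[OF assms(1) \<open>x \<in> T\<close>] by blast
  obtain V g' where g: "open V" "x \<in> V" "Ck_on k V g'" "\<And>y. y \<in> V \<Longrightarrow> y \<in> S \<Longrightarrow> g' y = g y"
    using Ck_extE[OF assms(2) \<open>x \<in> T\<close>] by blast
  have "Ck_on k (U \<inter> V) (\<lambda>x. h (f' x) (g' x))"
    by (rule assms(3)) (use f(1,3) g(1,3) in \<open>auto intro: Ck_on_subset\<close>)
  then show "\<exists>U g'. open U \<and> x \<in> U \<and> Ck_on k U g' \<and> (\<forall>y\<in>U \<inter> S. g' y = h (f y) (g y))"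
    using f g by (intro exI[of _ "U \<inter> V"] exI[of _ "\<lambda>x. h (f' x) (g' x)"]) auto
qed

lemma Ck_ext_add: "Ck_ext k T S f \<Longrightarrow> Ck_ext k T S g \<Longrightarrow> Ck_ext k T S (\<lambda>x. f x + g x)"
  by (rule Ck_ext_combine) (auto intro: Ck_on_add)

lemma Ck_ext_mult: "Ck_ext k T S f \<Longrightarrow> Ck_ext k T S g \<Longrightarrow> Ck_ext k T S (\<lambda>x. f x * g x)"
  by (rule Ck_ext_combine) (auto intro: Ck_on_mult)

lemma Ck_ext_sum: "(\<And>i. i \<in> I \<Longrightarrow> Ck_ext k T S (f i)) \<Longrightarrow> Ck_ext k T S (\<lambda>x. \<Sum>i\<in>I. f i x)"
  by (induction I rule: infinite_finite_induct) (auto intro!: Ck_ext_const Ck_ext_add)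

text \<open>The hypothesis \<open>T \<subseteq> S\<close> makes the extension agree with
  \<open>f\<close> at the point itself, hence positive there. Away from \<open>S\<close> the
  extension can take any sign, so its neighbourhood is shrunk to the open set where it is
  positive.\<close>

lemma Ck_ext_powr:
  assumes "Ck_ext k T S f" "T \<subseteq> S" "\<And>x. x \<in> T \<Longrightarrow> 0 < f x"
  shows "Ck_ext k T S (\<lambda>x. f x powr a)"
  unfolding Ck_ext_def
proof
  fix x assume x: "x \<in> T"
  obtain U f' where f: "open U" "x \<in> U" "Ck_on k U f'" "\<And>y. y \<in> U \<Longrightarrow> y \<in> S \<Longrightarrow> f' y = f y"
    using Ck_extE[OF assms(1) \<open>x \<in> T\<close>] by blast
  let ?V = "{y\<in>U. f' y \<in> {0<..}}"
  have V: "open ?V"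
    using continuous_open_preimage[OF Ck_on_imp_continuous_on[OF f(3)] f(1), of "{0<..}"]
    by (simp add: vimage_def Int_def)
  moreover have "x \<in> ?V" using f assms x by auto
  moreover have "Ck_on k ?V (\<lambda>x. f' x powr a)"
    by (rule Ck_on_powr[OF V]) (auto intro: Ck_on_subset[OF f(3)])
  ultimately show "\<exists>U g. open U \<and> x \<in> U \<and> Ck_on k U g \<and> (\<forall>y\<in>U \<inter> S. g y = f y powr a)"
    using f by (intro exI[of _ ?V] exI[of _ "\<lambda>x. f' x powr a"]) auto
qed

lemma Ck_ext_divide:
  assumes "Ck_ext k T S f" "Ck_ext k T S g" "T \<subseteq> S" "\<And>x. x \<in> S \<Longrightarrow> 0 < g x"
  shows "Ck_ext k T S (\<lambda>x. f x / g x)"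
proof -
  have "Ck_ext k T S (\<lambda>x. f x * g x powr (-1))"
    using assms by (intro Ck_ext_mult Ck_ext_powr) auto
  then show ?thesis
    by (rule Ck_ext_cong) (use assms(4) in \<open>auto simp: powr_minus divide_inverse less_imp_le\<close>)
qed

lemma Ck_ext_imp_Ck_on:
  assumes "open S" "S \<subseteq> T" "Ck_ext k T S f"
  shows "Ck_on k S f"
proof (rule Ck_on_local[OF assms(1)])
  fix x assume "x \<in> S"
  then obtain U g where g: "open U" "x \<in> U" "Ck_on k U g" "\<And>y. y \<in> U \<Longrightarrow> y \<in> S \<Longrightarrow> g y = f y"
    using Ck_extE[OF assms(3)] assms(2) by blast
  have "Ck_on k (U \<inter> S) f"
    by (rule Ck_on_cong[of _ g]) (use g assms(1) in \<open>auto intro: Ck_on_subset[OF g(3)]\<close>)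
  then show "\<exists>U. open U \<and> x \<in> U \<and> Ck_on k (U \<inter> S) f" using g by auto
qed

text \<open>Agreement of two functions on a set passes to their derivatives where the set is open,
  which is why agreement is asked on the open \<open>S\<close> and not on \<open>T\<close>.\<close>

lemma Ck_ext_partial:
  assumes "open S" "Ck_ext (Suc k) T S f"
  shows "Ck_ext k T S (\<lambda>x. frechet_derivative f (at x) v)"
  unfolding Ck_ext_def
proof
  fix x assume "x \<in> T"
  then obtain U g where g: "open U" "x \<in> U" "Ck_on (Suc k) U g" "\<And>y. y \<in> U \<Longrightarrow> y \<in> S \<Longrightarrow> g y = f y"
    using Ck_extE[OF assms(2)] by blast
  have "frechet_derivative g (at y) = frechet_derivative f (at y)" if "y \<in> U \<inter> S" for y
    by (rule frechet_derivative_cong_open[of "U \<inter> S"]) (use that g assms(1) in auto)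
  then show "\<exists>U g. open U \<and> x \<in> U \<and> Ck_on k U g \<and> (\<forall>y\<in>U \<inter> S. g y = frechet_derivative f (at y) v)"
    using g Ck_on_partial[OF g(3)]
    by (intro exI[of _ U] exI[of _ "\<lambda>x. frechet_derivative g (at x) v"]) auto
qed

text \<open>A local extension stays within 1 of its value at the centre on a small neighbourhood,
  and finitely many of these cover \<open>T\<close>. The bound is for \<open>S\<close> only: on the
  rest of \<open>T\<close> the values of \<open>f\<close> are unconstrained. Integrability on the
  domain and the domination in time both come from it.\<close>

lemma Ck_ext_bounded:
  assumes "compact T" "S \<subseteq> T" "Ck_ext k T S f"
  obtains C where "0 \<le> C" "\<And>x. x \<in> S \<Longrightarrow> \<bar>f x\<bar> \<le> C"
proof -
  have "\<exists>U C. open U \<and> x \<in> U \<and> (\<forall>y\<in>U \<inter> S. \<bar>f y\<bar> \<le> C)" if x: "x \<in> T" for x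
  proof -
    obtain U g where g: "open U" "x \<in> U" "Ck_on k U g" "\<And>y. y \<in> U \<Longrightarrow> y \<in> S \<Longrightarrow> g y = f y"
      using Ck_extE[OF assms(3) x] by blast
    let ?V = "{y\<in>U. g y \<in> ball (g x) 1}"
    have "open ?V"
      using continuous_open_preimage[OF Ck_on_imp_continuous_on[OF g(3)] g(1), of "ball (g x) 1"]
      by (simp add: vimage_def Int_def)
    then show ?thesis using g
      by (intro exI[of _ ?V] exI[of _ "\<bar>g x\<bar> + 1"]) (force simp: dist_real_def)
  qed
  then obtain U C where U: "\<And>x. x \<in> T \<Longrightarrow> open (U x) \<and> x \<in> U x \<and> (\<forall>y\<in>U x \<inter> S. \<bar>f y\<bar> \<le> C x)"
    by metis
  obtain P where P: "P \<subseteq> T" "finite P" "T \<subseteq> (\<Union>x\<in>P. U x)"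
    using compactE_image[OF assms(1), of T U] U by blast
  have "\<bar>f y\<bar> \<le> (\<Sum>x\<in>P. \<bar>C x\<bar>)" if y: "y \<in> S" for y
  proof -
    obtain x where x: "x \<in> P" "y \<in> U x" using P y assms(2) by blast
    then have "\<bar>f y\<bar> \<le> \<bar>C x\<bar>" using U[of x] y P by force
    also have "\<dots> \<le> (\<Sum>x\<in>P. \<bar>C x\<bar>)" using x P by (intro member_le_sum) auto
    finally show ?thesis .
  qed
  then show ?thesis by (intro that[of "\<Sum>x\<in>P. \<bar>C x\<bar>"]) (auto intro: sum_nonneg)
qed

section \<open>Integrability, and integrals of compactly supported derivatives\<close>

lemma set_integrable_bounded_continuous:
  fixes f :: "'a::euclidean_space \<Rightarrow> real"
  assumes "open S" "bounded S" "continuous_on S f" "\<And>x. x \<in> S \<Longrightarrow> \<bar>f x\<bar> \<le> C"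
  shows "set_integrable lborel S f"
  unfolding set_integrable_def
proof (rule Bochner_Integration.integrable_bound)
  show "integrable lborel (\<lambda>x. indicator S x *\<^sub>R C)"
    using assms(1) emeasure_bounded_finite[OF assms(2)]
    by (intro integrable_scaleR_left) (auto simp: integrable_indicator_iff)
  show "(\<lambda>x. indicator S x *\<^sub>R f x) \<in> borel_measurable lborel"
    using borel_measurable_continuous_on_indicator[of S f] assms by simp
  show "AE x in lborel. norm (indicator S x *\<^sub>R f x) \<le> norm (indicator S x *\<^sub>R C)"
    using assms(4) by (auto simp: indicator_def intro!: AE_I2 order_trans[OF assms(4)])
qed

lemma Ck_ext_set_integrable:
  assumes "open S" "bounded S" "Ck_ext k (closure S) S f"
  shows "set_integrable lborel S f"
proof -
  have "compact (closure S)" using assms by simp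
  from Ck_ext_bounded[OF this closure_subset assms(3)] obtain C where "\<And>x. x \<in> S \<Longrightarrow> \<bar>f x\<bar> \<le> C"
    by blast
  moreover have "continuous_on S f"
    by (rule Ck_on_imp_continuous_on[OF Ck_ext_imp_Ck_on[OF assms(1) closure_subset assms(3)]])
  ultimately show ?thesis using set_integrable_bounded_continuous assms by blast
qed

text \<open>
  Translation invariance makes the integral of every difference quotient vanish, so no Fubini
  argument is needed.
\<close>

lemma integral_frechet_derivative_compact_support:
  fixes f :: "'a::euclidean_space \<Rightarrow> real"
  assumes "open S" "compact K" "K \<subseteq> S" "Ck_on 1 S f" "\<And>x. x \<in> S - K \<Longrightarrow> f x = 0"
  shows "set_integrable lborel S (\<lambda>x. frechet_derivative f (at x) e)"
    and "(LINT x:S|lborel. frechet_derivative f (at x) e) = 0"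
proof -
  \<comment> \<open>Extension by zero: \<open>S\<close> and the complement of \<open>K\<close> are
    open and cover the space, and on their overlap both descriptions of \<open>g\<close> are zero.
    Hence \<open>g\<close> is differentiable everywhere, with derivative \<open>D\<close>.\<close>
  define g where "g x = (if x \<in> K then f x else 0)" for x
  define D where "D x = (if x \<in> K then frechet_derivative f (at x) else (\<lambda>_. 0))" for x
  have gK: "(g has_derivative (\<lambda>_. 0)) (at x)" if "x \<notin> K" for x
    by (rule has_derivative_transform_within_open[of "\<lambda>_. 0" _ _ UNIV "- K"])
      (use that assms(2) in \<open>auto simp: g_def compact_imp_closed\<close>)
  have gS: "(g has_derivative frechet_derivative f (at x)) (at x)" if "x \<in> S" for x
    by (rule has_derivative_transform_within_open[OF Ck_on_imp_has_derivative[OF assms(4)[unfolded One_nat_def] that] assms(1)])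
      (use that assms in \<open>auto simp: g_def\<close>)
  have gD: "(g has_derivative D x) (at x)" for x
    using gK[of x] gS[of x] assms(3) by (auto simp: D_def)
  have DS: "D x = frechet_derivative f (at x)" if "x \<in> S" for x
    using has_derivative_unique[OF gD[of x] gS[OF that]] .
  have "continuous_on S (\<lambda>x. D x e)"
    using assms(4) DS by (auto cong: continuous_on_cong)
  moreover have "continuous_on (- K) (\<lambda>x. D x e)"
    by (subst continuous_on_cong[OF refl, of _ _ "\<lambda>_. 0"]) (auto simp: D_def)
  ultimately have "continuous_on (S \<union> - K) (\<lambda>x. D x e)"
    using assms by (intro continuous_on_open_Un) (auto simp: compact_imp_closed)
  then have contD: "continuous_on UNIV (\<lambda>x. D x e)"
    by (rule continuous_on_subset) (use assms(3) in blast)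
  have "bounded ((\<lambda>x. D x e) ` K)"
    by (intro compact_imp_bounded compact_continuous_image assms(2) continuous_on_subset[OF contD]) auto
  then obtain B0 where B0: "\<And>x. x \<in> K \<Longrightarrow> norm (D x e) \<le> B0"
    unfolding bounded_iff by auto
  \<comment> \<open>For empty \<open>K\<close> the bound \<open>B0\<close> is arbitrary and may be
    negative; the maximum with 0 also covers the points outside \<open>K\<close>, where
    \<open>D\<close> is zero.\<close>
  define B where "B = max B0 0"
  have B: "norm (D x e) \<le> B" for x
    using B0[of x] by (cases "x \<in> K") (auto simp: B_def D_def)
  obtain R where R: "\<And>x. x \<in> K \<Longrightarrow> norm x \<le> R"
    using compact_imp_bounded[OF assms(2)] unfolding bounded_iff by auto
  have contg: "continuous_on UNIV g"
    using gD has_derivative_continuous by (blast intro: continuous_at_imp_continuous_on)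
  have gint: "integrable lborel g"
  proof -
    have "integrable lborel (\<lambda>x. indicator K x *\<^sub>R g x)"
      by (rule borel_integrable_compact[OF assms(2) continuous_on_subset[OF contg]]) auto
    moreover have "(\<lambda>x. indicator K x *\<^sub>R g x) = g" by (auto simp: g_def indicator_def)
    ultimately show ?thesis by simp
  qed
  have shift: "integrable lborel (\<lambda>x. g (a + x))" "(\<integral>x. g (a + x) \<partial>lborel) = (\<integral>x. g x \<partial>lborel)" for a
  proof -
    have m: "g \<in> borel_measurable lborel" using gint by auto
    have "integrable (distr lborel borel ((+) a)) g" using gint by (simp add: lborel_distr_plus)
    then show "integrable lborel (\<lambda>x. g (a + x))"
      by (subst (asm) integrable_distr_eq) (use m in auto)
    have "(\<integral>x. g x \<partial>distr lborel borel ((+) a)) = (\<integral>x. g (a + x) \<partial>lborel)"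
      by (rule integral_distr) (use m in auto)
    then show "(\<integral>x. g (a + x) \<partial>lborel) = (\<integral>x. g x \<partial>lborel)" by (simp add: lborel_distr_plus)
  qed
  define s :: "nat \<Rightarrow> real" where "s k = 1 / real (Suc k)" for k
  have s0: "s k > 0" "s k \<le> 1" for k by (auto simp: s_def)
  define q where "q k x = (g (s k *\<^sub>R e + x) - g x) / s k" for k x
  have line: "((\<lambda>r. g (r *\<^sub>R e + x)) has_real_derivative D (r *\<^sub>R e + x) e) (at r)" for r x
  proof -
    have "((\<lambda>r. g (r *\<^sub>R e + x)) has_derivative (\<lambda>h. D (r *\<^sub>R e + x) (h *\<^sub>R e))) (at r)"
      by (rule has_derivative_compose[OF _ gD]) (auto intro!: derivative_eq_intros)
    then show ?thesis
      unfolding has_field_derivative_def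
      by (rule has_derivative_eq_rhs)
        (auto simp: linear_simps(5)[OF has_derivative_bounded_linear[OF gD]] mult.commute)
  qed
  \<comment> \<open>Dominating function for the difference quotients. In the large ball the mean
    value theorem bounds them by \<open>B\<close>; outside it, since \<open>s k \<le> 1\<close>,
    neither \<open>x\<close> nor the shifted point can lie in \<open>K\<close>, and the quotient is
    zero.\<close>
  have qbound: "norm (q k x) \<le> indicator (cball 0 (R + norm e)) x *\<^sub>R B" for k x
  proof (cases "norm x \<le> R + norm e")
    case True
    have "\<exists>z. z > 0 \<and> z < s k \<and> g (s k *\<^sub>R e + x) - g (0 *\<^sub>R e + x) = (s k - 0) * D (z *\<^sub>R e + x) e"
      using MVT2[OF s0(1)[of k], of "\<lambda>r. g (r *\<^sub>R e + x)" "\<lambda>r. D (r *\<^sub>R e + x) e"] line by blast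
    then obtain z where "q k x = D (z *\<^sub>R e + x) e" using s0(1)[of k] by (auto simp: q_def)
    then show ?thesis using B True by (simp add: indicator_def)
  next
    case False
    have "norm x \<le> norm (s k *\<^sub>R e + x) + norm (s k *\<^sub>R e)"
      by (metis add_diff_cancel_left' norm_triangle_sub norm_minus_commute add.commute)
    also have "norm (s k *\<^sub>R e) \<le> norm e" using s0[of k] by (simp add: mult_left_le_one_le)
    finally have "s k *\<^sub>R e + x \<notin> K" using R[of "s k *\<^sub>R e + x"] False by auto
    moreover have "x \<notin> K" using R[of x] False norm_ge_zero[of e] by auto
    ultimately show ?thesis using False by (simp add: q_def g_def indicator_def)
  qed
  have "(\<lambda>k. \<integral>x. q k x \<partial>lborel) \<longlonglongrightarrow> (\<integral>x. D x e \<partial>lborel)"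
  proof (rule integral_dominated_convergence)
    show "(\<lambda>x. D x e) \<in> borel_measurable lborel"
      using contD borel_measurable_continuous_onI by auto
    show "q k \<in> borel_measurable lborel" for k
      using shift(1)[of "s k *\<^sub>R e"] gint unfolding q_def
      by (intro borel_measurable_divide borel_measurable_diff) auto
    show "integrable lborel (\<lambda>x. indicator (cball 0 (R + norm e)) x *\<^sub>R B)"
      by (rule borel_integrable_compact) auto
    show "AE x in lborel. norm (q k x) \<le> indicator (cball 0 (R + norm e)) x *\<^sub>R B" for k
      using qbound by simp
    show "AE x in lborel. (\<lambda>k. q k x) \<longlonglongrightarrow> D x e"
    proof (rule AE_I2)
      fix x
      have "((\<lambda>h. (g (h *\<^sub>R e + x) - g x) / h) \<longlongrightarrow> D x e) (at 0)"
        using line[of x 0] by (simp add: DERIV_def)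
      moreover have "s \<longlonglongrightarrow> 0"
        using LIMSEQ_inverse_real_of_nat by (simp add: s_def[abs_def] inverse_eq_divide)
      then have "filterlim s (at 0) sequentially"
        unfolding filterlim_at using s0(1) by (auto simp: less_imp_neq[symmetric])
      ultimately show "(\<lambda>k. q k x) \<longlonglongrightarrow> D x e"
        unfolding q_def by (rule filterlim_compose)
    qed
  qed
  moreover have "(\<integral>x. q k x \<partial>lborel) = 0" for k
    unfolding q_def using shift[of "s k *\<^sub>R e"] gint by simp
  ultimately have "(\<integral>x. D x e \<partial>lborel) = 0" by (simp add: LIMSEQ_const_iff)
  moreover have Deq: "(\<lambda>x. D x e) = (\<lambda>x. indicator S x *\<^sub>R frechet_derivative f (at x) e)"
  proof
    show "D x e = indicator S x *\<^sub>R frechet_derivative f (at x) e" for x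
      by (cases "x \<in> S") (use DS[of x] assms(3) in \<open>auto simp: D_def\<close>)
  qed
  ultimately show "(LINT x:S|lborel. frechet_derivative f (at x) e) = 0"
    by (simp add: set_lebesgue_integral_def)
  have "integrable lborel (\<lambda>x. indicator K x *\<^sub>R D x e)"
    by (rule borel_integrable_compact[OF assms(2) continuous_on_subset[OF contD]]) auto
  also have "(\<lambda>x. indicator K x *\<^sub>R D x e) = (\<lambda>x. D x e)" by (auto simp: D_def indicator_def)
  finally show "set_integrable lborel S (\<lambda>x. frechet_derivative f (at x) e)"
    unfolding set_integrable_def Deq .
qed

section \<open>The divergence theorem for tangential fields\<close>

lemma compact_superlevel_set:
  fixes f :: "'a::euclidean_space \<Rightarrow> real"
  assumes "compact K" "continuous_on K f"
  shows "compact {x\<in>K. c \<le> f x}"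
proof -
  have "closed (K \<inter> f -` {c..})"
    using assms by (intro continuous_closed_preimage) (auto simp: compact_imp_closed)
  moreover have "{x\<in>K. c \<le> f x} = K \<inter> (K \<inter> f -` {c..})" by auto
  ultimately show ?thesis using assms(1) compact_Int_closed by metis
qed

text \<open>
  The field is multiplied by \<open>\<eta> k \<psi> = (max 0 (1 - e\<^sub>k / \<psi>))\<^sup>2\<close> with \<open>e\<^sub>k \<rightarrow> 0\<close>. Since
  \<open>\<psi> \<eta>' k \<psi>\<close> is bounded and tends to \<open>0\<close> pointwise, the hypothesis on \<open>\<nabla>\<psi> \<cdot> Z\<close> removes the
  contribution of the cutoff in the limit.
\<close>

lemma divergence_integral_cutoff:
  fixes Z :: "'a::euclidean_space \<Rightarrow> 'a \<Rightarrow> real"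
  assumes "open \<Omega>" "bounded \<Omega>" "open B" "compact K" "K \<subseteq> B"
    and Z: "\<And>i. i \<in> Basis \<Longrightarrow> Ck_ext 1 (closure \<Omega>) \<Omega> (Z i)"
    and Z0: "\<And>i x. i \<in> Basis \<Longrightarrow> x \<in> \<Omega> - K \<Longrightarrow> Z i x = 0"
    and \<psi>: "Ck_on 1 B \<psi>" "\<And>x. x \<in> B \<Longrightarrow> x \<in> \<Omega> \<longleftrightarrow> 0 < \<psi> x"
    and bound: "\<And>x. x \<in> \<Omega> \<inter> K \<Longrightarrow>
      \<bar>\<Sum>i\<in>Basis. Z i x * frechet_derivative \<psi> (at x) i\<bar> \<le> C * \<psi> x"
  shows "(LINT x:\<Omega>|lborel. \<Sum>i\<in>Basis. frechet_derivative (Z i) (at x) i) = 0"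
proof -
  define W where "W = \<Omega> \<inter> B"
  have W: "open W" "W \<subseteq> \<Omega>" "W \<subseteq> B" using assms(1,3) by (auto simp: W_def)
  have \<psi>W: "0 < \<psi> x" if "x \<in> W" for x using that \<psi>(2) by (auto simp: W_def)
  have ZC: "Ck_on 1 \<Omega> (Z i)" if "i \<in> Basis" for i
    by (rule Ck_ext_imp_Ck_on[OF assms(1) closure_subset Z[OF that]])
  define divZ where "divZ x = (\<Sum>i\<in>Basis. frechet_derivative (Z i) (at x) i)" for x
  define h where "h x = (\<Sum>i\<in>Basis. Z i x * frechet_derivative \<psi> (at x) i)" for x
  have divext: "Ck_ext 0 (closure \<Omega>) \<Omega> divZ"
    unfolding divZ_def using Z by (intro Ck_ext_sum Ck_ext_partial assms(1)) auto
  have cl: "compact (closure \<Omega>)" using assms(2) by simp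
  from Ck_ext_bounded[OF cl closure_subset divext]
  obtain M where M: "0 \<le> M" "\<And>x. x \<in> \<Omega> \<Longrightarrow> \<bar>divZ x\<bar> \<le> M" by blast
  define e :: "nat \<Rightarrow> real" where "e k = inverse (real (Suc k))" for k
  have e0: "0 < e k" for k by (simp add: e_def)
  have elim: "e \<longlonglongrightarrow> 0" using LIMSEQ_inverse_real_of_nat by (simp add: e_def[abs_def])
  define \<eta> where "\<eta> k s = (max 0 (1 - e k / s))\<^sup>2" for k s
  define \<eta>' where "\<eta>' k s = 2 * max 0 (1 - e k / s) * (e k / s\<^sup>2)" for k s
  have \<eta>D: "(\<eta> k has_real_derivative \<eta>' k s) (at s)" if "s > 0" for k s
  proof -
    have "((\<lambda>s. 1 - e k / s) has_real_derivative e k / s\<^sup>2) (at s)"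
      using that by (auto intro!: derivative_eq_intros simp: power2_eq_square)
    from DERIV_chain2[OF has_real_derivative_max_square this]
    show ?thesis unfolding \<eta>_def \<eta>'_def .
  qed
  have \<eta>C: "Ck_on 1 W (\<lambda>x. \<eta> k (\<psi> x))" for k
  proof (rule C1_on_compose[OF W(1) Ck_on_subset[OF \<psi>(1) W(3)]])
    show "(\<eta> k has_real_derivative \<eta>' k (\<psi> x)) (at (\<psi> x))" if "x \<in> W" for x
      by (rule \<eta>D[OF \<psi>W[OF that]])
    have "continuous_on {0<..} (\<eta>' k)"
      unfolding \<eta>'_def by (auto intro!: continuous_intros)
    then show "continuous_on (\<psi> ` W) (\<eta>' k)"
      by (rule continuous_on_subset) (use \<psi>W in auto)
  qed
  define A where "A k x = \<eta> k (\<psi> x) * divZ x + \<eta>' k (\<psi> x) * h x" for k x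
  have derf: "frechet_derivative (\<lambda>x. \<eta> k (\<psi> x) * Z i x) (at x) i =
      \<eta> k (\<psi> x) * frechet_derivative (Z i) (at x) i + \<eta>' k (\<psi> x) * (Z i x * frechet_derivative \<psi> (at x) i)"
    if "x \<in> W" "i \<in> Basis" for k x i
  proof -
    have 1: "(\<psi> has_derivative frechet_derivative \<psi> (at x)) (at x)"
      by (rule Ck_on_imp_has_derivative[OF \<psi>(1)[unfolded One_nat_def]]) (use that W in auto)
    have 2: "(Z i has_derivative frechet_derivative (Z i) (at x)) (at x)"
      by (rule Ck_on_imp_has_derivative[OF ZC[OF that(2), unfolded One_nat_def]]) (use that W in auto)
    have 3: "((\<lambda>x. \<eta> k (\<psi> x)) has_derivative (\<lambda>v. \<eta>' k (\<psi> x) * frechet_derivative \<psi> (at x) v)) (at x)"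
      by (rule has_derivative_compose[OF 1 \<eta>D[OF \<psi>W[OF that(1)], unfolded has_field_derivative_def]])
    show ?thesis
      by (subst frechet_derivative_eqI[OF has_derivative_mult[OF 3 2]]) (simp add: algebra_simps)
  qed
  have part: "set_integrable lborel W (\<lambda>x. frechet_derivative (\<lambda>x. \<eta> k (\<psi> x) * Z i x) (at x) i)"
    "(LINT x:W|lborel. frechet_derivative (\<lambda>x. \<eta> k (\<psi> x) * Z i x) (at x) i) = 0"
    if i: "i \<in> Basis" for i k
  proof -
    \<comment> \<open>The cutoff vanishes where \<open>\<psi> < e k\<close> and the field vanishes
      off \<open>K\<close>. The remaining set is compact and, as \<open>\<psi>\<close> is positive
      on it, stays inside the domain: this is the compact support that \<open>Z\<close> itself may
      lack.\<close>
    have 1: "compact {x\<in>K. e k \<le> \<psi> x}"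
      by (rule compact_superlevel_set[OF assms(4)])
        (rule continuous_on_subset[OF Ck_on_imp_continuous_on[OF \<psi>(1)] assms(5)])
    have 2: "{x\<in>K. e k \<le> \<psi> x} \<subseteq> W"
      using \<psi>(2) assms(5) e0[of k] by (force simp: W_def)
    have 3: "Ck_on 1 W (\<lambda>x. \<eta> k (\<psi> x) * Z i x)"
      by (rule Ck_on_mult[OF W(1) \<eta>C Ck_on_subset[OF ZC[OF i] W(2)]])
    have 4: "\<eta> k (\<psi> x) * Z i x = 0" if "x \<in> W - {x\<in>K. e k \<le> \<psi> x}" for x
    proof (cases "x \<in> K")
      case True
      then have "\<psi> x < e k" "0 < \<psi> x" using that \<psi>W by auto
      then have "\<eta> k (\<psi> x) = 0" by (simp add: \<eta>_def field_simps max_def)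
      then show ?thesis by simp
    next
      case False
      then show ?thesis using Z0[OF i] that W by auto
    qed
    show "set_integrable lborel W (\<lambda>x. frechet_derivative (\<lambda>x. \<eta> k (\<psi> x) * Z i x) (at x) i)"
      "(LINT x:W|lborel. frechet_derivative (\<lambda>x. \<eta> k (\<psi> x) * Z i x) (at x) i) = 0"
      using integral_frechet_derivative_compact_support[OF W(1) 1 2 3 4] by auto
  qed
  have Asum: "A k x = (\<Sum>i\<in>Basis. frechet_derivative (\<lambda>x. \<eta> k (\<psi> x) * Z i x) (at x) i)" if "x \<in> W" for k x
    using derf[OF that] by (simp add: A_def divZ_def h_def sum_distrib_left sum.distrib)
  have Aint: "(\<integral>x. indicator W x *\<^sub>R A k x \<partial>lborel) = 0" "integrable lborel (\<lambda>x. indicator W x *\<^sub>R A k x)" for k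
  proof -
    have *: "indicator W x *\<^sub>R A k x
        = (\<Sum>i\<in>Basis. indicator W x *\<^sub>R frechet_derivative (\<lambda>x. \<eta> k (\<psi> x) * Z i x) (at x) i)" for x
      using Asum[of x k] by (cases "x \<in> W") auto
    show "(\<integral>x. indicator W x *\<^sub>R A k x \<partial>lborel) = 0"
      unfolding * using part[of _ k]
      by (subst Bochner_Integration.integral_sum) (auto simp: set_integrable_def set_lebesgue_integral_def)
    show "integrable lborel (\<lambda>x. indicator W x *\<^sub>R A k x)"
      unfolding * using part[of _ k] by (intro Bochner_Integration.integrable_sum) (auto simp: set_integrable_def)
  qed
  have Abound: "norm (indicator W x *\<^sub>R A k x) \<le> indicator \<Omega> x *\<^sub>R (M + 2 * \<bar>C\<bar>)" for k x
  proof (cases "x \<in> W")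
    case True
    then have x: "x \<in> \<Omega>" "0 < \<psi> x" using W \<psi>W by auto
    have "\<bar>\<eta> k (\<psi> x)\<bar> \<le> 1"
      using x e0[of k] by (auto simp: \<eta>_def power_le_one_iff max_def abs_le_square_iff field_simps power2_eq_square intro: mult_le_one)
    then have 1: "\<bar>\<eta> k (\<psi> x) * divZ x\<bar> \<le> 1 * M"
      unfolding abs_mult using M x by (intro mult_mono) auto
    \<comment> \<open>Where the product is not zero, \<open>e k \<le> \<psi> x\<close>, so
      \<open>e k / (\<psi> x)\<^sup>2\<close> is at most \<open>1 / \<psi> x\<close>; this growth is
      cancelled by \<open>\<bar>h x\<bar> \<le> \<bar>C\<bar> * \<psi> x\<close>. The absolute value
      appears because \<open>C\<close> may have either sign.\<close>
    have 2: "\<bar>\<eta>' k (\<psi> x) * h x\<bar> \<le> 2 * \<bar>C\<bar>"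
    proof (cases "x \<in> K \<and> e k \<le> \<psi> x")
      case True
      have hx: "\<bar>h x\<bar> \<le> \<bar>C\<bar> * \<psi> x"
        using bound[of x] True x by (auto simp: h_def intro: order_trans mult_right_mono)
      have "\<bar>\<eta>' k (\<psi> x)\<bar> \<le> 2 * 1 * (1 / \<psi> x)"
      proof -
        have "e k / (\<psi> x)\<^sup>2 \<le> 1 / \<psi> x"
          using True x by (simp add: field_simps power2_eq_square)
        moreover have "max 0 (1 - e k / \<psi> x) \<le> 1" using x e0[of k] by simp
        moreover have "0 \<le> e k / (\<psi> x)\<^sup>2" using e0[of k] by simp
        ultimately show ?thesis unfolding \<eta>'_def abs_mult
          by (intro mult_mono) auto
      qed
      then have "\<bar>\<eta>' k (\<psi> x) * h x\<bar> \<le> (2 * 1 * (1 / \<psi> x)) * (\<bar>C\<bar> * \<psi> x)"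
        unfolding abs_mult using hx x by (intro mult_mono) auto
      then show ?thesis using x by simp
    next
      case False
      then have "\<eta>' k (\<psi> x) = 0 \<or> h x = 0"
        using x Z0 by (auto simp: \<eta>'_def h_def max_def field_simps)
      then show ?thesis by auto
    qed
    show ?thesis using 1 2 True x by (simp add: A_def)
  next
    case False
    then show ?thesis using M by (simp add: indicator_def)
  qed
  have Alim: "(\<lambda>k. indicator W x *\<^sub>R A k x) \<longlonglongrightarrow> indicator W x *\<^sub>R divZ x" for x
  proof (cases "x \<in> W")
    case True
    have x: "\<psi> x \<noteq> 0" using \<psi>W[OF True] by simp
    have "(\<lambda>k. \<eta> k (\<psi> x)) \<longlonglongrightarrow> (max 0 (1 - 0 / \<psi> x))\<^sup>2"
      unfolding \<eta>_def by (intro tendsto_intros elim x)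
    moreover have "(\<lambda>k. \<eta>' k (\<psi> x)) \<longlonglongrightarrow> 2 * max 0 (1 - 0 / \<psi> x) * (0 / (\<psi> x)\<^sup>2)"
      unfolding \<eta>'_def using x by (intro tendsto_intros elim) auto
    ultimately have "(\<lambda>k. A k x) \<longlonglongrightarrow> 1 * divZ x + 0 * h x"
      unfolding A_def by (intro tendsto_intros) auto
    then show ?thesis using True by simp
  qed simp
  have "(\<lambda>k. \<integral>x. indicator W x *\<^sub>R A k x \<partial>lborel) \<longlonglongrightarrow> (\<integral>x. indicator W x *\<^sub>R divZ x \<partial>lborel)"
  proof (rule integral_dominated_convergence)
    have "continuous_on W divZ"
      by (rule continuous_on_subset[OF Ck_on_imp_continuous_on[OF
            Ck_ext_imp_Ck_on[OF assms(1) closure_subset divext]] W(2)])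
    then show "(\<lambda>x. indicator W x *\<^sub>R divZ x) \<in> borel_measurable lborel"
      using borel_measurable_continuous_on_indicator[of W divZ] W by simp
    show "integrable lborel (\<lambda>x. indicator \<Omega> x *\<^sub>R (M + 2 * \<bar>C\<bar>))"
      using assms(1) emeasure_bounded_finite[OF assms(2)]
      by (intro integrable_scaleR_left) (auto simp: integrable_indicator_iff)
    show "(\<lambda>x. indicator W x *\<^sub>R A k x) \<in> borel_measurable lborel" for k
      using Aint(2)[of k] by (rule borel_measurable_integrable)
    show "AE x in lborel. (\<lambda>k. indicator W x *\<^sub>R A k x) \<longlonglongrightarrow> indicator W x *\<^sub>R divZ x"
      by (rule AE_I2, rule Alim)
    show "AE x in lborel. norm (indicator W x *\<^sub>R A k x) \<le> indicator \<Omega> x *\<^sub>R (M + 2 * \<bar>C\<bar>)" for k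
      by (rule AE_I2, rule Abound)
  qed
  then have 0: "(\<integral>x. indicator W x *\<^sub>R divZ x \<partial>lborel) = 0"
    unfolding Aint(1) by (simp add: LIMSEQ_const_iff)
  \<comment> \<open>A point of the domain outside \<open>B\<close> lies in the open set
    \<open>\<Omega> - K\<close>, on which every component of \<open>Z\<close> vanishes; the
    divergence is zero there, so the integrals over \<open>W\<close> and over the domain
    agree.\<close>
  have eq: "indicator W x *\<^sub>R divZ x = indicator \<Omega> x *\<^sub>R divZ x" for x
  proof (cases "x \<in> \<Omega> - B")
    case True
    have "frechet_derivative (Z i) (at x) = frechet_derivative (\<lambda>_. 0) (at x)" if "i \<in> Basis" for i
      by (rule frechet_derivative_cong_open[of "\<Omega> - K"])
        (use True assms(1,4,5) Z0[OF that] in \<open>auto simp: compact_imp_closed\<close>)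
    then have "divZ x = 0" by (simp add: divZ_def)
    then show ?thesis by simp
  qed (auto simp: W_def indicator_def)
  show ?thesis using 0[unfolded eq] unfolding set_lebesgue_integral_def divZ_def .
qed

section \<open>Gradients, mean values along segments, and normal components near the
  boundary\<close>

lemma frechet_derivative_eq_gradient:
  assumes "f differentiable (at x)"
  shows "frechet_derivative f (at x) v = gradient f x \<bullet> v"
proof -
  have lin: "linear (frechet_derivative f (at x))"
    using linear_frechet_derivative[OF assms] .
  have "frechet_derivative f (at x) v = frechet_derivative f (at x) (\<Sum>i\<in>Basis. (v \<bullet> i) *\<^sub>R i)"
    by (simp add: euclidean_representation)
  also have "\<dots> = (\<Sum>i\<in>Basis. (v \<bullet> i) * frechet_derivative f (at x) i)"
    by (simp add: linear_sum[OF lin] linear_cmul[OF lin])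
  also have "\<dots> = gradient f x \<bullet> v"
    by (simp add: gradient_def inner_sum_left inner_commute[of v] mult.commute)
  finally show ?thesis .
qed

lemma gradient_inner_Basis: "i \<in> Basis \<Longrightarrow> gradient f x \<bullet> i = frechet_derivative f (at x) i"
  by (simp add: gradient_def inner_sum_left inner_Basis if_distrib cong: if_cong)

lemma norm_gradient_squared:
  "(norm (gradient f x))\<^sup>2 = (\<Sum>i\<in>Basis. (frechet_derivative f (at x) i)\<^sup>2)"
proof -
  have "(norm (gradient f x))\<^sup>2 = (\<Sum>i\<in>Basis. (gradient f x \<bullet> i) * (gradient f x \<bullet> i))"
    unfolding power2_norm_eq_inner by (rule euclidean_inner)
  also have "\<dots> = (\<Sum>i\<in>Basis. (frechet_derivative f (at x) i)\<^sup>2)"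
    by (intro sum.cong) (auto simp: gradient_inner_Basis power2_eq_square)
  finally show ?thesis .
qed

lemma smooth_on_imp_Ck_ext: "smooth_on S f \<Longrightarrow> Ck_ext k S S f"
  unfolding smooth_on_def Ck_ext_def by meson

lemma smooth_on_imp_Ck_on: "open S \<Longrightarrow> smooth_on S f \<Longrightarrow> Ck_on k S f"
  by (rule Ck_ext_imp_Ck_on[OF _ subset_refl]) (auto intro: smooth_on_imp_Ck_ext)

lemma has_real_derivative_line:
  fixes f :: "'a::euclidean_space \<Rightarrow> real"
  assumes "Ck_on 1 V f" "x + r *\<^sub>R v \<in> V"
  shows "((\<lambda>r. f (x + r *\<^sub>R v)) has_real_derivative frechet_derivative f (at (x + r *\<^sub>R v)) v) (at r)"
proof -
  let ?D = "frechet_derivative f (at (x + r *\<^sub>R v))"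
  have D: "(f has_derivative ?D) (at (x + r *\<^sub>R v))"
    using Ck_on_imp_has_derivative[OF assms(1)[unfolded One_nat_def] assms(2)] .
  have "((\<lambda>r. f (x + r *\<^sub>R v)) has_derivative (\<lambda>h. ?D (h *\<^sub>R v))) (at r)"
    by (rule has_derivative_compose[of "\<lambda>r. x + r *\<^sub>R v" "\<lambda>h. h *\<^sub>R v" r UNIV f ?D, OF _ D])
      (auto intro!: derivative_eq_intros)
  then show ?thesis
    unfolding has_field_derivative_def
    by (rule has_derivative_eq_rhs)
      (auto simp: linear_simps(5)[OF has_derivative_bounded_linear[OF D]] mult.commute)
qed

lemma MVT_directional:
  fixes f :: "'a::euclidean_space \<Rightarrow> real"
  assumes "Ck_on 1 V f" "0 < s" "\<And>r. 0 \<le> r \<Longrightarrow> r \<le> s \<Longrightarrow> x + r *\<^sub>R v \<in> V"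
  obtains r where "0 < r" "r < s"
    "f (x + s *\<^sub>R v) - f x = s * frechet_derivative f (at (x + r *\<^sub>R v)) v"
proof -
  have "\<exists>z. z > 0 \<and> z < s \<and> f (x + s *\<^sub>R v) - f (x + 0 *\<^sub>R v)
      = (s - 0) * frechet_derivative f (at (x + z *\<^sub>R v)) v"
    using MVT2[OF assms(2), of "\<lambda>r. f (x + r *\<^sub>R v)" "\<lambda>r. frechet_derivative f (at (x + r *\<^sub>R v)) v"]
      has_real_derivative_line[OF assms(1)] assms(3) by blast
  then show ?thesis using that by auto
qed

lemma isCont_eventually_less:
  fixes f :: "'a::t2_space \<Rightarrow> real"
  assumes "isCont f p" "f p < c"
  shows "\<forall>\<^sub>F x in nhds p. f x < c"
  using assms by (metis isCont_def tendsto_at_iff_tendsto_nhds order_tendstoD(2))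

text \<open>Phrased as a limit from inside because the components \<open>X i\<close> carry
  information on the domain only; the normal is frozen at \<open>p\<close> while \<open>x\<close>
  approaches it. For components that extend continuously it says that the extended field has no
  normal part on the boundary.\<close>

definition tangential :: "'a::euclidean_space set \<Rightarrow> ('a \<Rightarrow> 'a \<Rightarrow> real) \<Rightarrow> bool" where
  "tangential \<Omega> X \<longleftrightarrow> (\<forall>p\<in>frontier \<Omega>. \<forall>\<nu>. outward_unit_normal \<Omega> p \<nu> \<longrightarrow>
     ((\<lambda>x. \<Sum>i\<in>Basis. X i x * (\<nu> \<bullet> i)) \<longlongrightarrow> 0) (at p within \<Omega>))"

text \<open>
  The product \<open>h = \<nabla>\<phi> \<cdot> X\<close> vanishes on the boundary. Moving from \<open>x\<close> in the direction \<open>\<nabla>\<phi> p\<close>, along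
  which \<open>\<phi>\<close> increases at rate at least \<open>c\<close>, one meets the boundary after a time \<open>q \<le> \<bar>\<phi> x\<bar> / c\<close>.
\<close>

lemma tangential_bound:
  fixes X :: "'a::euclidean_space \<Rightarrow> 'a \<Rightarrow> real"
  assumes "open \<Omega>" "local_defining_function \<Omega> p U \<phi>" "p \<in> frontier \<Omega>"
    and X: "\<And>i. i \<in> Basis \<Longrightarrow> Ck_ext 1 (closure \<Omega>) \<Omega> (X i)"
    and "tangential \<Omega> X"
  obtains r C where "0 < r" "ball p r \<subseteq> U"
    "\<And>x. x \<in> ball p r \<inter> \<Omega> \<Longrightarrow>
       \<bar>\<Sum>i\<in>Basis. X i x * frechet_derivative \<phi> (at x) i\<bar> \<le> C * - \<phi> x"
proof -
  have U: "open U" "p \<in> U" "smooth_on U \<phi>" "\<And>x. x \<in> U \<Longrightarrow> gradient \<phi> x \<noteq> 0"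
    "\<And>x. x \<in> U \<Longrightarrow> x \<in> \<Omega> \<longleftrightarrow> \<phi> x < 0" "\<And>x. x \<in> U \<Longrightarrow> x \<in> frontier \<Omega> \<longleftrightarrow> \<phi> x = 0"
    using assms(2) unfolding local_defining_function_def by blast+
  have \<phi>C: "Ck_on k U \<phi>" for k by (rule smooth_on_imp_Ck_on[OF U(1,3)])
  have grad: "frechet_derivative \<phi> (at x) v = gradient \<phi> x \<bullet> v" if "x \<in> U" for x v
    using that \<phi>C[of 1] by (intro frechet_derivative_eq_gradient) auto
  have "p \<in> closure \<Omega>" using assms(3) by (auto simp: frontier_def)
  then have "\<exists>V g. open V \<and> p \<in> V \<and> Ck_on 1 V g \<and> (\<forall>y\<in>V \<inter> \<Omega>. g y = X i y)" if "i \<in> Basis" for i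
    using X[OF that] unfolding Ck_ext_def by blast
  then obtain V g where Vg: "\<And>i. i \<in> Basis \<Longrightarrow>
      open (V i) \<and> p \<in> V i \<and> Ck_on 1 (V i) (g i) \<and> (\<forall>y\<in>V i \<inter> \<Omega>. g i y = X i y)"
    by metis
  define N where "N = U \<inter> (\<Inter>i\<in>Basis. V i)"
  have N: "open N" "p \<in> N" "N \<subseteq> U" "\<And>i. i \<in> Basis \<Longrightarrow> N \<subseteq> V i"
    using U Vg by (auto simp: N_def intro!: open_Int open_INT)
  have gC: "Ck_on 1 N (g i)" if "i \<in> Basis" for i
    using Ck_on_subset[OF _ N(4)[OF that]] Vg[OF that] by blast
  have gX: "g i y = X i y" if "i \<in> Basis" "y \<in> N" "y \<in> \<Omega>" for i y
    using Vg N that by blast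
  \<comment> \<open>\<open>h\<close> uses the extensions \<open>g i\<close>, which are C^1 in a full
    neighbourhood of \<open>p\<close>: the segments below end on the boundary, where the
    \<open>X i\<close> are uncontrolled. One derivative of \<open>\<phi>\<close> is spent here, so
    \<open>\<phi>\<close> enters as a C^2 function.\<close>
  define h where "h x = (\<Sum>i\<in>Basis. g i x * frechet_derivative \<phi> (at x) i)" for x
  have hC: "Ck_on 1 N h"
    unfolding h_def using \<phi>C[of 2]
    by (intro Ck_on_sum N(1) Ck_on_mult gC)
      (auto simp: numeral_2_eq_2 intro!: Ck_on_subset[OF _ N(3)] simp del: Ck_on.simps intro: Ck_on_partial)
  \<comment> \<open>\<open>U\<close> and \<open>\<phi>\<close> are defining data at every boundary
    point \<open>y\<close> in \<open>N\<close>, so the normalised gradient at \<open>y\<close> is an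
    admissible normal. The limit from inside is 0 by tangency and the value of the extension by
    continuity; it is unique because \<open>y\<close> is a limit point of the open set.\<close>
  have h0: "h y = 0" if y: "y \<in> N" "y \<in> frontier \<Omega>" for y
  proof -
    let ?n = "gradient \<phi> y" let ?\<nu> = "?n /\<^sub>R norm ?n"
    have yU: "y \<in> U" using y N by auto
    then have n0: "norm ?n > 0" using U(4) by simp
    have "local_defining_function \<Omega> y U \<phi>"
      using assms(2) yU unfolding local_defining_function_def by blast
    then have "outward_unit_normal \<Omega> y ?\<nu>"
      using y(2) unfolding outward_unit_normal_def by blast
    then have "((\<lambda>x. \<Sum>i\<in>Basis. X i x * (?\<nu> \<bullet> i)) \<longlongrightarrow> 0) (at y within \<Omega>)"
      using assms(5) y(2) unfolding tangential_def by blast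
    moreover have "((\<lambda>x. \<Sum>i\<in>Basis. X i x * (?\<nu> \<bullet> i)) \<longlongrightarrow> (\<Sum>i\<in>Basis. g i y * (?\<nu> \<bullet> i))) (at y within \<Omega>)"
    proof (intro tendsto_intros)
      fix i :: 'a assume i: "i \<in> Basis"
      have "isCont (g i) y"
        using Ck_on_imp_continuous_on[OF gC[OF i]] N(1) y(1) continuous_on_eq_continuous_at by blast
      then have "(g i \<longlongrightarrow> g i y) (at y within \<Omega>)"
        unfolding isCont_def by (rule tendsto_within_subset) simp
      moreover have "\<forall>\<^sub>F x in at y within \<Omega>. g i x = X i x"
        using eventually_at_in_open'[OF N(1) y(1)] gX[OF i]
        unfolding eventually_at_filter by (auto elim: eventually_mono)
      ultimately show "(X i \<longlongrightarrow> g i y) (at y within \<Omega>)"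
        using tendsto_cong by fast
    qed
    moreover have "at y within \<Omega> \<noteq> bot"
    proof -
      have "y \<in> closure \<Omega>" "y \<notin> \<Omega>" using y(2) assms(1) by (auto simp: frontier_def interior_open)
      then have "y islimpt \<Omega>" by (auto simp: closure_def)
      then show ?thesis by (simp add: trivial_limit_within)
    qed
    ultimately have 0: "(\<Sum>i\<in>Basis. g i y * (?\<nu> \<bullet> i)) = 0"
      using tendsto_unique by blast
    have "h y = norm ?n * (\<Sum>i\<in>Basis. g i y * (?\<nu> \<bullet> i))"
      unfolding h_def sum_distrib_left using n0 by (intro sum.cong) (auto simp: gradient_inner_Basis)
    then show ?thesis using 0 by simp
  qed
  define n where "n = gradient \<phi> p"
  have n0: "norm n > 0" using U(2,4) by (simp add: n_def)
  \<comment> \<open>The derivative of \<open>\<phi>\<close> at \<open>p\<close> in direction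
    \<open>n\<close> equals \<open>(norm n)\<^sup>2\<close>; half of it remains a lower bound near
    \<open>p\<close>. Likewise the summand 1 in \<open>L\<close> leaves room to bound the derivative
    of \<open>h\<close> near \<open>p\<close>.\<close>
  define c where "c = (norm n)\<^sup>2 / 2"
  have c0: "c > 0" using n0 by (simp add: c_def)
  define L where "L = \<bar>frechet_derivative h (at p) n\<bar> + 1"
  have L0: "L > 0" by (simp add: L_def)
  have cont: "isCont f p" if "Ck_on k N f" for f and k
    using Ck_on_imp_continuous_on[OF that] N continuous_on_eq_continuous_at by blast
  have "isCont (\<lambda>x. frechet_derivative \<phi> (at x) n) p"
    by (rule cont[of 0], rule Ck_on_partial, rule Ck_on_subset[OF \<phi>C N(3)])
  moreover have "frechet_derivative \<phi> (at p) n > c"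
    using n0 grad[OF U(2)] by (simp add: n_def[symmetric] c_def power2_norm_eq_inner[symmetric])
  ultimately have "\<forall>\<^sub>F x in nhds p. frechet_derivative \<phi> (at x) n > c"
    by (metis continuous_at_imp_continuous_within isCont_def tendsto_at_iff_tendsto_nhds order_tendstoD(1))
  moreover have "isCont (\<lambda>x. \<bar>frechet_derivative h (at x) n\<bar>) p"
    using cont[of 0, OF Ck_on_partial[of 0]] hC by (auto intro!: continuous_intros)
  then have "\<forall>\<^sub>F x in nhds p. \<bar>frechet_derivative h (at x) n\<bar> < L"
    by (rule isCont_eventually_less) (simp add: L_def)
  moreover have "\<forall>\<^sub>F x in nhds p. x \<in> N" using N(1,2) eventually_nhds by blast
  ultimately have "\<forall>\<^sub>F x in nhds p. frechet_derivative \<phi> (at x) n > c \<and>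
      \<bar>frechet_derivative h (at x) n\<bar> < L \<and> x \<in> N" by eventually_elim auto
  then obtain d where d: "d > 0" "\<And>x. dist x p < d \<Longrightarrow> frechet_derivative \<phi> (at x) n > c \<and>
      \<bar>frechet_derivative h (at x) n\<bar> < L \<and> x \<in> N"
    unfolding eventually_nhds_metric by blast
  have "isCont (\<lambda>x. \<bar>\<phi> x\<bar>) p" using cont[OF Ck_on_subset[OF \<phi>C N(3)]] by (auto intro!: continuous_intros)
  moreover have "\<phi> p = 0" using U(2,6) assms(3) by blast
  \<comment> \<open>The threshold makes the time \<open>- \<phi> x / c\<close>, allowed for reaching
    the boundary, a displacement of less than \<open>d / 2\<close>. The other \<open>d / 2\<close>
    is reserved for the distance from \<open>x\<close> to \<open>p\<close>, so the whole segment
    stays within distance \<open>d\<close> of \<open>p\<close>.\<close>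
  ultimately have "\<forall>\<^sub>F x in nhds p. \<bar>\<phi> x\<bar> < c * (d / 2) / norm n"
    by (intro isCont_eventually_less) (use c0 d n0 in auto)
  then obtain d' where d': "d' > 0" "\<And>x. dist x p < d' \<Longrightarrow> \<bar>\<phi> x\<bar> < c * (d / 2) / norm n"
    unfolding eventually_nhds_metric by blast
  define r where "r = min d' (d / 2)"
  have r: "r > 0" using d d' by (simp add: r_def)
  have sub: "ball p r \<subseteq> N"
  proof
    fix x assume "x \<in> ball p r"
    then have "dist x p < d" using d(1) by (simp add: r_def dist_commute)
    then show "x \<in> N" using d(2) by blast
  qed
  have "\<bar>\<Sum>i\<in>Basis. X i x * frechet_derivative \<phi> (at x) i\<bar> \<le> L / c * - \<phi> x"
    if x: "x \<in> ball p r \<inter> \<Omega>" for x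
  proof -
    have xN: "x \<in> N" and x\<Omega>: "x \<in> \<Omega>" using x sub by auto
    have hx: "h x = (\<Sum>i\<in>Basis. X i x * frechet_derivative \<phi> (at x) i)"
      unfolding h_def using gX[OF _ xN x\<Omega>] by simp
    have neg: "\<phi> x < 0" using U(5) xN N(3) x\<Omega> by blast
    define s where "s = - \<phi> x / c"
    have s0: "s > 0" using divide_pos_pos[of "- \<phi> x" c] neg c0 by (simp add: s_def)
    have "\<bar>\<phi> x\<bar> < c * (d / 2) / norm n" using d'(2)[of x] x by (simp add: r_def dist_commute)
    then have "s * norm n < d / 2" using neg c0 n0 by (simp add: s_def field_simps)
    then have seg: "dist (x + q *\<^sub>R n) p < d" if "0 \<le> q" "q \<le> s" for q
    proof -
      have "dist (x + q *\<^sub>R n) p \<le> norm (q *\<^sub>R n) + dist x p"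
        by (metis add_diff_eq dist_norm norm_triangle_ineq add.commute)
      moreover have "norm (q *\<^sub>R n) \<le> s * norm n" using that by (simp add: mult_right_mono)
      moreover have "dist x p < d / 2" using x by (simp add: r_def dist_commute)
      ultimately show ?thesis using \<open>s * norm n < d / 2\<close> by linarith
    qed
    have segN: "x + q *\<^sub>R n \<in> N" if "0 \<le> q" "q \<le> s" for q using seg[OF that] d(2) by blast
    have \<phi>N: "Ck_on 1 N \<phi>" by (rule Ck_on_subset[OF \<phi>C N(3)])
    obtain z where z: "0 < z" "z < s"
      "\<phi> (x + s *\<^sub>R n) - \<phi> x = s * frechet_derivative \<phi> (at (x + z *\<^sub>R n)) n"
      using MVT_directional[OF \<phi>N s0 segN] by blast
    have "c \<le> frechet_derivative \<phi> (at (x + z *\<^sub>R n)) n" using d(2)[OF seg[of z]] z by simp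
    then have "s * c \<le> s * frechet_derivative \<phi> (at (x + z *\<^sub>R n)) n" using s0 by (simp add: mult_left_mono)
    then have "0 \<le> \<phi> (x + s *\<^sub>R n)" using z(3) c0 by (simp add: s_def)
    moreover have "continuous_on {0..s} (\<lambda>q. \<phi> (x + q *\<^sub>R n))"
      by (rule continuous_on_compose2[OF Ck_on_imp_continuous_on[OF \<phi>N]])
        (use segN in \<open>auto intro!: continuous_intros\<close>)
    ultimately obtain q where q: "0 \<le> q" "q \<le> s" "\<phi> (x + q *\<^sub>R n) = 0"
      using IVT'[of "\<lambda>q. \<phi> (x + q *\<^sub>R n)" 0 0 s] neg s0 by auto
    have q0: "0 < q" using q neg by (cases "q = 0") auto
    have yN: "x + q *\<^sub>R n \<in> N" using segN q by blast
    have "x + q *\<^sub>R n \<in> frontier \<Omega>" using U(6) yN N(3) q(3) by blast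
    then have hy: "h (x + q *\<^sub>R n) = 0" using h0 yN by blast
    have segN': "x + t *\<^sub>R n \<in> N" if "0 \<le> t" "t \<le> q" for t using segN that q by simp
    obtain a where a: "0 < a" "a < q"
      "h (x + q *\<^sub>R n) - h x = q * frechet_derivative h (at (x + a *\<^sub>R n)) n"
      using MVT_directional[OF hC q0 segN'] by blast
    obtain b where b: "0 < b" "b < q"
      "\<phi> (x + q *\<^sub>R n) - \<phi> x = q * frechet_derivative \<phi> (at (x + b *\<^sub>R n)) n"
      using MVT_directional[OF \<phi>N q0 segN'] by blast
    have "\<bar>frechet_derivative h (at (x + a *\<^sub>R n)) n\<bar> \<le> L"
      using d(2)[OF seg[of a]] a q by simp
    then have "\<bar>h x\<bar> \<le> q * L"
      using a(3) hy q0 by (simp add: abs_mult abs_minus_commute flip: abs_minus_cancel[of "h x"])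
    moreover have "q * c \<le> - \<phi> x"
    proof -
      have "c \<le> frechet_derivative \<phi> (at (x + b *\<^sub>R n)) n" using d(2)[OF seg[of b]] b q by simp
      then have "q * c \<le> q * frechet_derivative \<phi> (at (x + b *\<^sub>R n)) n" using q0 by (simp add: mult_left_mono)
      then show ?thesis using b(3) q(3) by simp
    qed
    then have "q * L \<le> L / c * - \<phi> x"
      using mult_left_mono[of "q * c" "- \<phi> x" "L / c"] L0 c0 by (simp add: field_simps)
    ultimately show ?thesis by (simp add: hx)
  qed
  then show ?thesis using that[OF r] sub N(3) by blast
qed

section \<open>Bump functions and the divergence theorem on the whole domain\<close>

definition bump :: "'a::euclidean_space \<Rightarrow> real \<Rightarrow> 'a \<Rightarrow> real" where
  "bump p r x = (max 0 (r\<^sup>2 - (x - p) \<bullet> (x - p)))\<^sup>2"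

lemma bump_nonneg: "0 \<le> bump p r x"
  by (simp add: bump_def)

lemma bump_pos: "x \<in> ball p r \<Longrightarrow> 0 < bump p r x"
proof -
  assume "x \<in> ball p r"
  then have "norm (x - p) < r" by (simp add: dist_norm norm_minus_commute)
  then have "(norm (x - p))\<^sup>2 < r\<^sup>2" by (simp add: power_strict_mono)
  then show ?thesis by (simp add: bump_def power2_norm_eq_inner)
qed

lemma bump_eq_0: "0 \<le> r \<Longrightarrow> x \<notin> cball p r \<Longrightarrow> bump p r x = 0"
proof -
  assume "0 \<le> r" "x \<notin> cball p r"
  then have "r < norm (x - p)" by (simp add: dist_norm norm_minus_commute)
  then have "r\<^sup>2 < (norm (x - p))\<^sup>2" using \<open>0 \<le> r\<close> by (simp add: power_strict_mono)
  then show ?thesis by (simp add: bump_def power2_norm_eq_inner)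
qed

text \<open>The squared distance, unlike the distance, is differentiable at the centre, and the
  squared positive part leaves no corner at the edge of the ball.\<close>

lemma C1_bump: "Ck_on 1 UNIV (bump p r)"
proof -
  have "Ck_on 1 UNIV (\<lambda>x. r\<^sup>2 - (x - p) \<bullet> (x - p))"
    unfolding One_nat_def
    by (rule Ck_on_SucI[where f' = "\<lambda>x v. - (2 * ((x - p) \<bullet> v))"])
      (auto intro!: derivative_eq_intros continuous_intros simp: inner_commute)
  then show ?thesis
    unfolding bump_def[abs_def]
    by (rule C1_on_compose[where g = "\<lambda>y. (max 0 y)\<^sup>2" and g' = "\<lambda>y. 2 * max 0 y", OF open_UNIV])
      (auto intro!: continuous_intros has_real_derivative_max_square simp del: Ck_on.simps)
qed

lemma set_integral_finite_sum:
  fixes f :: "'i \<Rightarrow> 'a \<Rightarrow> real"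
  assumes "\<And>i. i \<in> I \<Longrightarrow> set_integrable M S (f i)"
  shows "(LINT x:S|M. \<Sum>i\<in>I. f i x) = (\<Sum>i\<in>I. LINT x:S|M. f i x)"
  using assms unfolding set_lebesgue_integral_def set_integrable_def scaleR_sum_right
  by (rule Bochner_Integration.integral_sum)

text \<open>Each point of the closure has a ball with a function \<open>\<psi>\<close> that is
  positive exactly on the part inside the domain and controls the component of \<open>X\<close>
  along its gradient. Normalised bumps split \<open>X\<close> into fields \<open>Z p\<close>, each
  supported in one ball; their weights lie between 0 and 1, so the control carries over to
  \<open>Z p\<close>.\<close>

theorem divergence_integral_tangential:
  fixes X :: "'a::euclidean_space \<Rightarrow> 'a \<Rightarrow> real"
  assumes "open \<Omega>" "bounded \<Omega>" "smooth_boundary \<Omega>"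
    and X: "\<And>i. i \<in> Basis \<Longrightarrow> Ck_ext 1 (closure \<Omega>) \<Omega> (X i)"
    and "tangential \<Omega> X"
  shows "(LINT x:\<Omega>|lborel. \<Sum>i\<in>Basis. frechet_derivative (X i) (at x) i) = 0"
proof -
  define Q where "Q p r \<psi> C \<longleftrightarrow> 0 < r \<and> Ck_on 1 (ball p r) \<psi> \<and> (\<forall>x\<in>ball p r. x \<in> \<Omega> \<longleftrightarrow> 0 < \<psi> x) \<and>
      (\<forall>x\<in>ball p r \<inter> \<Omega>. \<bar>\<Sum>i\<in>Basis. X i x * frechet_derivative \<psi> (at x) i\<bar> \<le> C * \<psi> x)" for p r \<psi> C
  have ex: "\<exists>r \<psi> C. Q p r \<psi> C"
    if p: "p \<in> closure \<Omega>" for p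
  proof (cases "p \<in> \<Omega>")
    case True
    then obtain r where "r > 0" "ball p r \<subseteq> \<Omega>" using assms(1) openE by blast
    \<comment> \<open>In the interior the constant 1 plays the role of \<open>\<psi>\<close>: the
      ball lies in \<open>\<Omega>\<close> and all derivatives are zero, so \<open>C = 0\<close>
      works.\<close>
    then show ?thesis unfolding Q_def
      by (intro exI[of _ r] exI[of _ "\<lambda>_. 1"] exI[of _ 0]) (auto intro: Ck_on_const simp del: Ck_on.simps)
  next
    case False
    then have pf: "p \<in> frontier \<Omega>" using p assms(1) by (simp add: frontier_def interior_open)
    then obtain U \<phi> where U: "local_defining_function \<Omega> p U \<phi>"
      using assms(3) unfolding smooth_boundary_def by blast
    from tangential_bound[OF assms(1) U pf X assms(5)] obtain r C where r: "0 < r" "ball p r \<subseteq> U"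
      "\<And>x. x \<in> ball p r \<inter> \<Omega> \<Longrightarrow> \<bar>\<Sum>i\<in>Basis. X i x * frechet_derivative \<phi> (at x) i\<bar> \<le> C * - \<phi> x"
      by blast
    have \<phi>C: "Ck_on 1 (ball p r) \<phi>"
      using U r(2) smooth_on_imp_Ck_on Ck_on_subset unfolding local_defining_function_def by blast
    have neg: "Ck_on 1 (ball p r) (\<lambda>x. - 1 * \<phi> x)"
      by (intro Ck_on_mult Ck_on_const \<phi>C) auto
    have der: "frechet_derivative (\<lambda>x. - \<phi> x) (at x) v = - frechet_derivative \<phi> (at x) v"
      if "x \<in> ball p r" for x v
      by (rule frechet_derivative_eqI, rule has_derivative_minus,
          rule Ck_on_imp_has_derivative[OF \<phi>C[unfolded One_nat_def] that])
    have "\<forall>x\<in>ball p r. x \<in> \<Omega> \<longleftrightarrow> 0 < - \<phi> x"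
      using U r(2) unfolding local_defining_function_def by auto
    moreover have "\<forall>x\<in>ball p r \<inter> \<Omega>. \<bar>\<Sum>i\<in>Basis. X i x * frechet_derivative (\<lambda>x. - \<phi> x) (at x) i\<bar> \<le> C * - \<phi> x"
      using r(3) by (simp add: der sum_negf)
    ultimately show ?thesis using r(1) neg unfolding Q_def
      by (intro exI[of _ r] exI[of _ "\<lambda>x. - \<phi> x"] exI[of _ C]) simp
  qed
  have "\<forall>p\<in>closure \<Omega>. \<exists>r \<psi> C. Q p r \<psi> C" using ex by (rule ballI)
  then obtain r \<psi> C where "\<forall>p\<in>closure \<Omega>. Q p (r p) (\<psi> p) (C p)"
    unfolding bchoice_iff by (elim exE) (rule that)
  note loc = this[rule_format, unfolded Q_def]
  have comp: "compact (closure \<Omega>)" using assms(2) by simp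
  \<comment> \<open>The cover uses half of each radius: the bump at \<open>p\<close> then vanishes
    off the closed ball of radius \<open>r p / 2\<close>, a compact subset of the ball on which
    \<open>\<psi> p\<close> is available.\<close>
  have cover: "closure \<Omega> \<subseteq> (\<Union>p\<in>closure \<Omega>. ball p (r p / 2))"
  proof
    fix p assume p: "p \<in> closure \<Omega>"
    then have "p \<in> ball p (r p / 2)" using loc[OF p] by simp
    then show "p \<in> (\<Union>p\<in>closure \<Omega>. ball p (r p / 2))" using p by blast
  qed
  obtain P where "P \<subseteq> closure \<Omega>" "finite P" "closure \<Omega> \<subseteq> (\<Union>p\<in>P. ball p (r p / 2))"
    by (rule compactE_image[OF comp _ cover]) auto
  note P = this
  define b where "b p = bump p (r p / 2)" for p
  define S where "S x = (\<Sum>p\<in>P. b p x)" for x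
  have S0: "0 < S x" if x: "x \<in> closure \<Omega>" for x
  proof -
    obtain p where "p \<in> P" "x \<in> ball p (r p / 2)" using P(3) x by blast
    then show ?thesis unfolding S_def b_def
      by (intro sum_pos2[OF P(2), of p] bump_pos bump_nonneg)
  qed
  define Z where "Z p i x = b p x / S x * X i x" for p i x
  have bC: "Ck_ext 1 (closure \<Omega>) (closure \<Omega>) (b p)" for p
    unfolding b_def by (rule Ck_on_imp_Ck_ext[OF open_UNIV C1_bump]) simp
  have SC: "Ck_ext 1 (closure \<Omega>) (closure \<Omega>) S"
    unfolding S_def by (rule Ck_ext_sum[OF bC])
  \<comment> \<open>The quotient is formed relative to the closure, since division needs agreement
    and positivity at boundary points too. Agreement is afterwards restricted to
    \<open>\<Omega>\<close>, as for \<open>X i\<close>.\<close>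
  have ZC: "Ck_ext 1 (closure \<Omega>) \<Omega> (Z p i)" if "i \<in> Basis" for p i
    unfolding Z_def
    by (rule Ck_ext_mult[OF Ck_ext_mono[OF Ck_ext_divide[OF bC SC]] X[OF that]])
      (use S0 closure_subset in auto)
  have Zint: "(LINT x:\<Omega>|lborel. \<Sum>i\<in>Basis. frechet_derivative (Z p i) (at x) i) = 0" if p: "p \<in> P" for p
  proof (rule divergence_integral_cutoff[OF assms(1,2) open_ball compact_cball _ ZC])
    have pc: "p \<in> closure \<Omega>" using p P by blast
    have rp: "0 < r p" using loc[OF pc] by blast
    then show sub: "cball p (r p / 2) \<subseteq> ball p (r p)" by auto
    show "Ck_on 1 (ball p (r p)) (\<psi> p)" using loc[OF pc] by blast
    show "x \<in> \<Omega> \<longleftrightarrow> 0 < \<psi> p x" if "x \<in> ball p (r p)" for x using loc[OF pc] that by blast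
    show "Z p i x = 0" if "x \<in> \<Omega> - cball p (r p / 2)" for i x
      using bump_eq_0[of "r p / 2" x p] that rp by (simp add: Z_def b_def)
    show "\<bar>\<Sum>i\<in>Basis. Z p i x * frechet_derivative (\<psi> p) (at x) i\<bar> \<le> C p * \<psi> p x"
      if x: "x \<in> \<Omega> \<inter> cball p (r p / 2)" for x
    proof -
      have x1: "x \<in> ball p (r p) \<inter> \<Omega>" using x sub by blast
      have Sx: "0 < S x" using S0 x closure_subset by blast
      have "b p x \<le> S x" unfolding S_def
        by (rule member_le_sum[OF p _ P(2)]) (simp add: b_def bump_nonneg)
      then have q: "0 \<le> b p x / S x" "b p x / S x \<le> 1" using Sx by (auto simp: b_def bump_nonneg)
      have "(\<Sum>i\<in>Basis. Z p i x * frechet_derivative (\<psi> p) (at x) i)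
          = b p x / S x * (\<Sum>i\<in>Basis. X i x * frechet_derivative (\<psi> p) (at x) i)"
        by (simp add: Z_def sum_distrib_left mult.assoc)
      then have "\<bar>\<Sum>i\<in>Basis. Z p i x * frechet_derivative (\<psi> p) (at x) i\<bar>
          = b p x / S x * \<bar>\<Sum>i\<in>Basis. X i x * frechet_derivative (\<psi> p) (at x) i\<bar>"
        by (simp only: abs_mult abs_of_nonneg[OF q(1)])
      also have "\<dots> \<le> \<bar>\<Sum>i\<in>Basis. X i x * frechet_derivative (\<psi> p) (at x) i\<bar>"
        by (rule mult_left_le_one_le[OF abs_ge_zero q])
      also have "\<dots> \<le> C p * \<psi> p x" using loc[OF pc] x1 by blast
      finally show ?thesis .
    qed
  qed
  have split: "(\<Sum>i\<in>Basis. frechet_derivative (X i) (at x) i)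
      = (\<Sum>p\<in>P. \<Sum>i\<in>Basis. frechet_derivative (Z p i) (at x) i)" if x: "x \<in> \<Omega>" for x
  proof -
    have "frechet_derivative (X i) (at x) i = (\<Sum>p\<in>P. frechet_derivative (Z p i) (at x) i)"
      if i: "i \<in> Basis" for i
    proof -
      have "X i y = (\<Sum>p\<in>P. Z p i y)" if "y \<in> \<Omega>" for y
      proof -
        have "(\<Sum>p\<in>P. Z p i y) = S y / S y * X i y"
          unfolding Z_def sum_distrib_right[symmetric] sum_divide_distrib[symmetric] S_def ..
        moreover have "0 < S y" using S0 that closure_subset by blast
        ultimately show ?thesis by simp
      qed
      then have "frechet_derivative (X i) (at x) = frechet_derivative (\<lambda>y. \<Sum>p\<in>P. Z p i y) (at x)"
        by (rule frechet_derivative_cong_open[OF assms(1) x])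
      moreover have "((\<lambda>y. \<Sum>p\<in>P. Z p i y) has_derivative
          (\<lambda>v. \<Sum>p\<in>P. frechet_derivative (Z p i) (at x) v)) (at x)"
        by (rule has_derivative_sum, rule Ck_on_imp_has_derivative[OF
            Ck_ext_imp_Ck_on[OF assms(1) closure_subset ZC[OF i, unfolded One_nat_def]] x])
      ultimately show ?thesis using frechet_derivative_eqI by metis
    qed
    then show ?thesis by (subst sum.swap) simp
  qed
  have "(LINT x:\<Omega>|lborel. \<Sum>i\<in>Basis. frechet_derivative (X i) (at x) i)
      = (LINT x:\<Omega>|lborel. \<Sum>p\<in>P. \<Sum>i\<in>Basis. frechet_derivative (Z p i) (at x) i)"
    by (rule set_lebesgue_integral_cong) (use assms(1) split in auto)
  also have "\<dots> = (\<Sum>p\<in>P. LINT x:\<Omega>|lborel. \<Sum>i\<in>Basis. frechet_derivative (Z p i) (at x) i)"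
    by (rule set_integral_finite_sum)
      (intro Ck_ext_set_integrable[OF assms(1,2), of 0] Ck_ext_sum Ck_ext_partial assms(1)
        ZC[unfolded One_nat_def])
  also have "\<dots> = 0" using Zint by simp
  finally show ?thesis .
qed

section \<open>Green identity and differentiation under the integral\<close>

text \<open>The extension \<open>g\<close> has a two-sided derivative along the normal, while the
  Neumann condition looks at \<open>w\<close> from inside. The two meet on the ray
  \<open>p + s *\<^sub>R \<nu>\<close> for small negative \<open>s\<close>: the defining function
  increases along \<open>\<nu>\<close>, so it is negative there, the ray runs in the domain and
  \<open>g = w\<close> on it. Hence the normal derivative of \<open>g\<close> at \<open>p\<close> is
  zero, and continuity of the gradient of \<open>g\<close> gives the limit.\<close>

lemma tangential_times_gradient:
  fixes w :: "'a::euclidean_space \<Rightarrow> real"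
  assumes "open \<Omega>" "Ck_ext 2 (closure \<Omega>) (closure \<Omega>) w" "zero_normal_derivative \<Omega> w"
  shows "tangential \<Omega> (\<lambda>i x. w x * frechet_derivative w (at x) i)"
  unfolding tangential_def
proof (intro ballI allI impI)
  fix p \<nu> assume p: "p \<in> frontier \<Omega>" and \<nu>: "outward_unit_normal \<Omega> p \<nu>"
  have pc: "p \<in> closure \<Omega>" using p by (auto simp: frontier_def)
  from Ck_extE[OF assms(2) pc] obtain U g where
    g: "open U" "p \<in> U" "Ck_on 2 U g" "\<And>y. y \<in> U \<Longrightarrow> y \<in> closure \<Omega> \<Longrightarrow> g y = w y" by metis
  have g1: "Ck_on 1 U g" by (rule Ck_on_le[OF g(3)]) simp
  have lin: "frechet_derivative g (at x) \<nu> = (\<Sum>i\<in>Basis. frechet_derivative g (at x) i * (\<nu> \<bullet> i))"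
    if "x \<in> U" for x
    using frechet_derivative_eq_gradient[of g x \<nu>] g1 that
    by (simp add: gradient_def inner_sum_left inner_commute[of \<nu>])
  have gp: "frechet_derivative g (at p) \<nu> = 0"
  proof -
    obtain V \<phi> where V: "local_defining_function \<Omega> p V \<phi>"
      and \<nu>eq: "\<nu> = gradient \<phi> p /\<^sub>R norm (gradient \<phi> p)"
      using \<nu> unfolding outward_unit_normal_def by blast
    have V': "open V" "p \<in> V" "smooth_on V \<phi>" "gradient \<phi> p \<noteq> 0"
      "\<And>x. x \<in> V \<Longrightarrow> x \<in> \<Omega> \<longleftrightarrow> \<phi> x < 0" "\<phi> p = 0"
      using V p unfolding local_defining_function_def by blast+
    have \<phi>C: "Ck_on 1 V \<phi>" by (rule smooth_on_imp_Ck_on[OF V'(1,3)])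
    have "frechet_derivative \<phi> (at p) \<nu> = gradient \<phi> p \<bullet> \<nu>"
      using \<phi>C V'(2) by (intro frechet_derivative_eq_gradient) auto
    also have "\<dots> = norm (gradient \<phi> p)"
      using V'(4) by (simp add: \<nu>eq dot_square_norm power2_eq_square)
    finally have pos: "frechet_derivative \<phi> (at p) \<nu> > 0" using V'(4) by simp
    have "((\<lambda>s. \<phi> (p + s *\<^sub>R \<nu>)) has_real_derivative frechet_derivative \<phi> (at p) \<nu>) (at 0)"
      using has_real_derivative_line[OF \<phi>C, of p 0 \<nu>] V'(2) by simp
    from DERIV_pos_inc_left[OF this pos] obtain d where
      d: "d > 0" "\<And>h. 0 < h \<Longrightarrow> h < d \<Longrightarrow> \<phi> (p + (- h) *\<^sub>R \<nu>) < 0"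
      using V'(6) by auto
    have ev1: "\<forall>\<^sub>F s in at_left 0. \<phi> (p + s *\<^sub>R \<nu>) < 0"
      unfolding eventually_at_left_field using d(1) d(2)[of "- s" for s] by (intro exI[of _ "- d"]) auto
    have cont: "((\<lambda>s. p + s *\<^sub>R \<nu>) \<longlongrightarrow> p) (at_left 0)"
      by (auto intro!: tendsto_eq_intros)
    have "\<forall>\<^sub>F s in at_left 0. p + s *\<^sub>R \<nu> \<in> U \<inter> V"
      by (rule topological_tendstoD[OF cont]) (use g V' in auto)
    with ev1 have "\<forall>\<^sub>F s in at_left 0. g (p + s *\<^sub>R \<nu>) = w (p + s *\<^sub>R \<nu>)"
    proof eventually_elim
      case (elim s)
      then show ?case using V'(5) g(4) closure_subset by blast
    qed
    then have ev: "\<forall>\<^sub>F s in at_left 0. (w (p + s *\<^sub>R \<nu>) - w (p + 0 *\<^sub>R \<nu>)) / (s - 0)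
        = (g (p + s *\<^sub>R \<nu>) - g (p + 0 *\<^sub>R \<nu>)) / (s - 0)"
      by eventually_elim (use g(2,4) pc in simp)
    have "((\<lambda>s. w (p + s *\<^sub>R \<nu>)) has_real_derivative 0) (at_left 0)"
      using assms(3) p \<nu> unfolding zero_normal_derivative_def by blast
    then have l1: "((\<lambda>s. (g (p + s *\<^sub>R \<nu>) - g (p + 0 *\<^sub>R \<nu>)) / (s - 0)) \<longlongrightarrow> 0) (at_left 0)"
      unfolding has_field_derivative_iff using tendsto_cong[OF ev] by blast
    have "((\<lambda>s. g (p + s *\<^sub>R \<nu>)) has_real_derivative frechet_derivative g (at p) \<nu>) (at 0)"
      using has_real_derivative_line[OF g1, of p 0 \<nu>] g(2) by simp
    then have "((\<lambda>s. g (p + s *\<^sub>R \<nu>)) has_real_derivative frechet_derivative g (at p) \<nu>) (at_left 0)"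
      by (rule has_field_derivative_at_within)
    then have "((\<lambda>s. (g (p + s *\<^sub>R \<nu>) - g (p + 0 *\<^sub>R \<nu>)) / (s - 0)) \<longlongrightarrow> frechet_derivative g (at p) \<nu>) (at_left 0)"
      unfolding has_field_derivative_iff .
    with l1 show ?thesis using tendsto_unique[OF trivial_limit_at_left_real] by blast
  qed
  have cont: "isCont f p" if "Ck_on k U f" for f and k
    using Ck_on_imp_continuous_on[OF that] g(1,2) continuous_on_eq_continuous_at by blast
  have "isCont (\<lambda>x. g x * frechet_derivative g (at x) \<nu>) p"
    by (intro isCont_mult cont[OF g1] cont[of 0, OF Ck_on_partial] g1[unfolded One_nat_def])
  then have "((\<lambda>x. g x * frechet_derivative g (at x) \<nu>) \<longlongrightarrow> g p * frechet_derivative g (at p) \<nu>) (at p within \<Omega>)"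
    unfolding isCont_def by (rule tendsto_within_subset) simp
  moreover have "\<forall>\<^sub>F x in at p within \<Omega>. g x * frechet_derivative g (at x) \<nu>
      = (\<Sum>i\<in>Basis. w x * frechet_derivative w (at x) i * (\<nu> \<bullet> i))"
  proof -
    have "g x * frechet_derivative g (at x) \<nu> = (\<Sum>i\<in>Basis. w x * frechet_derivative w (at x) i * (\<nu> \<bullet> i))"
      if x: "x \<in> U" "x \<in> \<Omega>" for x
    proof -
      have "frechet_derivative g (at x) = frechet_derivative w (at x)"
        by (rule frechet_derivative_cong_open[of "U \<inter> \<Omega>"])
          (use g assms(1) x closure_subset in auto)
      moreover have "g x = w x" using g(4) x closure_subset by blast
      ultimately show ?thesis using lin[OF x(1)] by (simp add: sum_distrib_left mult.assoc)
    qed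
    then show ?thesis
      using eventually_at_in_open'[OF g(1,2)]
      unfolding eventually_at_filter by (auto elim: eventually_mono)
  qed
  ultimately show "((\<lambda>x. \<Sum>i\<in>Basis. w x * frechet_derivative w (at x) i * (\<nu> \<bullet> i)) \<longlongrightarrow> 0) (at p within \<Omega>)"
    using tendsto_cong by (force simp: gp)
qed

text \<open>The product rule gives div (w grad w) = w \<Delta>w + |grad w|^2. One derivative is
  spent on forming the field and one on its divergence, hence order 2 for \<open>w\<close>. The
  integrability claims allow the integral of the sum to be split.\<close>

theorem Neumann_Green_identity:
  fixes w :: "'a::euclidean_space \<Rightarrow> real"
  assumes "open \<Omega>" "bounded \<Omega>" "smooth_boundary \<Omega>"
    and "Ck_ext 2 (closure \<Omega>) (closure \<Omega>) w" "zero_normal_derivative \<Omega> w"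
  shows "set_integrable lborel \<Omega> (\<lambda>x. (norm (gradient w x))\<^sup>2)"
    and "set_integrable lborel \<Omega> (\<lambda>x. w x * laplacian w x)"
    and "(LINT x:\<Omega>|lborel. w x * laplacian w x) = - (LINT x:\<Omega>|lborel. (norm (gradient w x))\<^sup>2)"
proof -
  have w: "Ck_ext (Suc (Suc 0)) (closure \<Omega>) \<Omega> w"
    using Ck_ext_mono[OF assms(4) _ subset_refl closure_subset, of 2] by (simp add: numeral_2_eq_2)
  have w1: "Ck_ext (Suc 0) (closure \<Omega>) \<Omega> w" by (rule Ck_ext_mono[OF w]) auto
  have w0: "Ck_ext 0 (closure \<Omega>) \<Omega> w" by (rule Ck_ext_mono[OF w]) auto
  have dw: "Ck_ext (Suc 0) (closure \<Omega>) \<Omega> (\<lambda>x. frechet_derivative w (at x) i)" for i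
    by (rule Ck_ext_partial[OF assms(1) w])
  have X: "Ck_ext 1 (closure \<Omega>) \<Omega> (\<lambda>x. w x * frechet_derivative w (at x) i)" for i
    unfolding One_nat_def by (rule Ck_ext_mult[OF w1 dw])
  show 1: "set_integrable lborel \<Omega> (\<lambda>x. (norm (gradient w x))\<^sup>2)"
    unfolding norm_gradient_squared unfolding power2_eq_square
    by (intro Ck_ext_set_integrable[OF assms(1,2), of "Suc 0"] Ck_ext_sum Ck_ext_mult dw)
  show 2: "set_integrable lborel \<Omega> (\<lambda>x. w x * laplacian w x)"
    unfolding laplacian_def
    by (intro Ck_ext_set_integrable[OF assms(1,2), of 0] Ck_ext_sum Ck_ext_mult w0
        Ck_ext_partial[OF assms(1)] dw)
  have "(LINT x:\<Omega>|lborel. \<Sum>i\<in>Basis. frechet_derivative (\<lambda>x. w x * frechet_derivative w (at x) i) (at x) i) = 0"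
    by (rule divergence_integral_tangential[OF assms(1-3) X
          tangential_times_gradient[OF assms(1,4,5)]])
  also have "(LINT x:\<Omega>|lborel. \<Sum>i\<in>Basis. frechet_derivative (\<lambda>x. w x * frechet_derivative w (at x) i) (at x) i)
      = (LINT x:\<Omega>|lborel. w x * laplacian w x + (norm (gradient w x))\<^sup>2)"
  proof (rule set_lebesgue_integral_cong)
    show "\<forall>x. x \<in> \<Omega> \<longrightarrow> (\<Sum>i\<in>Basis. frechet_derivative (\<lambda>x. w x * frechet_derivative w (at x) i) (at x) i)
        = w x * laplacian w x + (norm (gradient w x))\<^sup>2"
    proof (intro allI impI)
      fix x assume x: "x \<in> \<Omega>"
      have "frechet_derivative (\<lambda>x. w x * frechet_derivative w (at x) i) (at x) i
          = w x * frechet_derivative (\<lambda>y. frechet_derivative w (at y) i) (at x) i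
            + (frechet_derivative w (at x) i)\<^sup>2" for i
      proof -
        have 1: "(w has_derivative frechet_derivative w (at x)) (at x)"
          by (rule Ck_on_imp_has_derivative[OF Ck_ext_imp_Ck_on[OF assms(1) closure_subset w1] x])
        have 2: "((\<lambda>y. frechet_derivative w (at y) i) has_derivative
            frechet_derivative (\<lambda>y. frechet_derivative w (at y) i) (at x)) (at x)"
          by (rule Ck_on_imp_has_derivative[OF Ck_ext_imp_Ck_on[OF assms(1) closure_subset dw] x])
        show ?thesis
          by (subst frechet_derivative_eqI[OF has_derivative_mult[OF 1 2]]) (simp add: power2_eq_square)
      qed
      then show "(\<Sum>i\<in>Basis. frechet_derivative (\<lambda>x. w x * frechet_derivative w (at x) i) (at x) i)
          = w x * laplacian w x + (norm (gradient w x))\<^sup>2"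
        by (simp add: norm_gradient_squared laplacian_def sum.distrib sum_distrib_left)
    qed
  qed (use assms(1) in auto)
  also have "\<dots> = (LINT x:\<Omega>|lborel. w x * laplacian w x) + (LINT x:\<Omega>|lborel. (norm (gradient w x))\<^sup>2)"
    by (rule set_integral_add(2)[OF 2 1])
  finally show "(LINT x:\<Omega>|lborel. w x * laplacian w x) = - (LINT x:\<Omega>|lborel. (norm (gradient w x))\<^sup>2)"
    by simp
qed

text \<open>Dominated convergence along sequences: the bound on \<open>f'\<close> makes each
  \<open>f x\<close> Lipschitz with constant \<open>C\<close>, so the difference quotients are
  dominated by a constant, which is integrable because the bounded set \<open>S\<close> has finite
  measure.\<close>

lemma has_real_derivative_set_integral:
  fixes f :: "'a::euclidean_space \<Rightarrow> real \<Rightarrow> real"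
  assumes "open S" "bounded S" "a < t" "t < b"
    and int: "\<And>s. a < s \<Longrightarrow> s < b \<Longrightarrow> set_integrable lborel S (\<lambda>x. f x s)"
    and int': "set_integrable lborel S (\<lambda>x. f' x t)"
    and der: "\<And>x s. x \<in> S \<Longrightarrow> a < s \<Longrightarrow> s < b \<Longrightarrow> (f x has_real_derivative f' x s) (at s)"
    and bound: "\<And>x s. x \<in> S \<Longrightarrow> a < s \<Longrightarrow> s < b \<Longrightarrow> \<bar>f' x s\<bar> \<le> C"
  shows "((\<lambda>s. LINT x:S|lborel. f x s) has_real_derivative (LINT x:S|lborel. f' x t)) (at t)"
proof -
  let ?I = "\<lambda>s. LINT x:S|lborel. f x s"
  have lip: "\<bar>f x s - f x t\<bar> \<le> C * \<bar>s - t\<bar>" if "x \<in> S" "a < s" "s < b" for x s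
    using field_differentiable_bound[of "{a<..<b}" "f x" "f' x" C s t] der bound that assms(3,4)
    by (auto intro: has_field_derivative_at_within)
  have "((\<lambda>s. (?I s - ?I t) / (s - t)) \<longlongrightarrow> (LINT x:S|lborel. f' x t)) (at t within {a<..<b})"
    unfolding tendsto_at_iff_sequentially
  proof (intro allI impI)
    fix X :: "nat \<Rightarrow> real"
    assume X: "\<forall>i. X i \<in> {a<..<b} - {t}" and lim: "X \<longlonglongrightarrow> t"
    have Xi: "a < X i" "X i < b" "X i \<noteq> t" for i using X by auto
    have "(\<lambda>i. \<integral>x. indicator S x *\<^sub>R ((f x (X i) - f x t) / (X i - t)) \<partial>lborel)
        \<longlonglongrightarrow> (\<integral>x. indicator S x *\<^sub>R f' x t \<partial>lborel)"
    proof (rule integral_dominated_convergence)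
      show "(\<lambda>x. indicator S x *\<^sub>R f' x t) \<in> borel_measurable lborel"
        using int' unfolding set_integrable_def by (rule borel_measurable_integrable)
      show "integrable lborel (\<lambda>x. indicator S x *\<^sub>R C)"
        using assms(1) emeasure_bounded_finite[OF assms(2)]
        by (intro integrable_scaleR_left) (auto simp: integrable_indicator_iff)
      show "(\<lambda>x. indicator S x *\<^sub>R ((f x (X i) - f x t) / (X i - t))) \<in> borel_measurable lborel" for i
      proof -
        have "set_integrable lborel S (\<lambda>x. (f x (X i) - f x t) / (X i - t))"
          using int Xi assms(3,4) by (intro set_integrable_divide set_integral_diff(1)) auto
        then show ?thesis unfolding set_integrable_def by (rule borel_measurable_integrable)
      qed
      show "AE x in lborel. (\<lambda>i. indicator S x *\<^sub>R ((f x (X i) - f x t) / (X i - t))) \<longlonglongrightarrow> indicator S x *\<^sub>R f' x t"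
      proof (rule AE_I2)
        fix x
        show "(\<lambda>i. indicator S x *\<^sub>R ((f x (X i) - f x t) / (X i - t))) \<longlonglongrightarrow> indicator S x *\<^sub>R f' x t"
        proof (cases "x \<in> S")
          case True
          have "((\<lambda>s. (f x s - f x t) / (s - t)) \<longlongrightarrow> f' x t) (at t)"
            using der[OF True assms(3,4)] unfolding has_field_derivative_iff .
          moreover have "filterlim X (at t) sequentially"
            using lim Xi(3) by (auto simp: filterlim_at)
          ultimately show ?thesis using True by (auto intro: filterlim_compose)
        qed simp
      qed
      show "AE x in lborel. norm (indicator S x *\<^sub>R ((f x (X i) - f x t) / (X i - t))) \<le> indicator S x *\<^sub>R C" for i
        using lip[OF _ Xi(1,2), of _ i] Xi(3)[of i]
        by (intro AE_I2) (auto simp: indicator_def field_simps)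
    qed
    moreover have "((\<lambda>s. (?I s - ?I t) / (s - t)) \<circ> X) i
        = (\<integral>x. indicator S x *\<^sub>R ((f x (X i) - f x t) / (X i - t)) \<partial>lborel)" for i
    proof -
      have "(LINT x:S|lborel. (f x (X i) - f x t) / (X i - t)) = (?I (X i) - ?I t) / (X i - t)"
        by (subst set_integral_divide_zero, subst set_integral_diff(2))
          (use int Xi assms(3,4) in auto)
      then show ?thesis unfolding o_def by (subst (asm) eq_commute) (simp only: set_lebesgue_integral_def)
    qed
    ultimately show "((\<lambda>s. (?I s - ?I t) / (s - t)) \<circ> X) \<longlonglongrightarrow> (LINT x:S|lborel. f' x t)"
      unfolding set_lebesgue_integral_def by presburger
  qed
  then show ?thesis
    using at_within_open[of t "{a<..<b}"] assms(3,4) by (simp add: has_field_derivative_iff)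
qed

section \<open>The Lyapunov functional\<close>

text \<open>The factor \<open>f x powr r / f x\<close> stands in place of
  \<open>f x powr (r - 1)\<close>. A single power then serves as an atom, and later identities
  become identities of rational functions. The \<open>within\<close> form covers one-sided
  derivatives at the boundary.\<close>

lemma DERIV_powr_base:
  assumes "(f has_real_derivative f') (at x within S)" "0 < f x"
  shows "((\<lambda>s. f s powr r) has_real_derivative r * (f x powr r / f x) * f') (at x within S)"
  using DERIV_chain2[OF has_real_derivative_powr[OF assms(2), of r] assms(1)] assms(2)
  by (simp add: powr_diff)

text \<open>Transfers the Neumann conditions of \<open>u\<close> and \<open>\<gamma>\<close> to the
  quantity under the Laplacian: the one-sided chain and quotient rules see only the values at the
  boundary point and the two vanishing derivatives.\<close>

lemma zero_normal_derivative_powr_divide: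
  assumes "zero_normal_derivative \<Omega> u" "zero_normal_derivative \<Omega> g"
    and "\<And>x. x \<in> closure \<Omega> \<Longrightarrow> 0 < u x \<and> 0 < g x"
  shows "zero_normal_derivative \<Omega> (\<lambda>x. u x powr n / g x)"
  unfolding zero_normal_derivative_def
proof (intro ballI allI impI)
  fix p \<nu> assume p: "p \<in> frontier \<Omega>" and \<nu>: "outward_unit_normal \<Omega> p \<nu>"
  have pos: "0 < u p" "0 < g p" using assms(3)[of p] p by (auto simp: frontier_def)
  have "((\<lambda>s. u (p + s *\<^sub>R \<nu>)) has_real_derivative 0) (at_left 0)"
    using assms(1) p \<nu> unfolding zero_normal_derivative_def by blast
  then have "((\<lambda>s. u (p + s *\<^sub>R \<nu>) powr n) has_real_derivative 0) (at_left 0)"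
    using DERIV_powr_base[of "\<lambda>s. u (p + s *\<^sub>R \<nu>)" 0 0 "{..<0}" n] pos by simp
  moreover have "((\<lambda>s. g (p + s *\<^sub>R \<nu>)) has_real_derivative 0) (at_left 0)"
    using assms(2) p \<nu> unfolding zero_normal_derivative_def by blast
  ultimately show "((\<lambda>s. u (p + s *\<^sub>R \<nu>) powr n / g (p + s *\<^sub>R \<nu>)) has_real_derivative 0) (at_left 0)"
    using DERIV_divide[of "\<lambda>s. u (p + s *\<^sub>R \<nu>) powr n" 0 0 "{..<0}" "\<lambda>s. g (p + s *\<^sub>R \<nu>)" 0] pos
    by simp
qed

lemma DERIV_F:
  assumes "(v has_real_derivative v') (at s)" "(g has_real_derivative g') (at s)"
    and "0 < v s" "0 < g s" "m > 0" "n - m + 1 \<noteq> 0"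
  shows "((\<lambda>s. F n m (v s) (g s)) has_real_derivative
      (n + 1) * v s powr n / g s * v' +
      (g s powr ((n + 1) / m - 2) - v s powr (n + 1) / (g s)\<^sup>2) * g') (at s)"
proof -
  have e: "(n - m + 1) / m = (n + 1) / m - 2 + 1" using assms(5) by (simp add: field_simps)
  \<comment> \<open>The normalisation of the second term of \<open>F\<close> cancels the exponent
    brought down by differentiation; \<open>n - m + 1 \<noteq> 0\<close> enters here.\<close>
  have c: "m / (n - m + 1) * ((n - m + 1) / m) = 1" using assms(5,6) by simp
  have g: "g s powr ((n - m + 1) / m) / g s = g s powr ((n + 1) / m - 2)"
    unfolding e using assms(4) by (subst powr_add) simp
  have v: "v s powr (n + 1) / v s = v s powr n" using assms(3) by (subst powr_add) simp
  have main: "((\<lambda>s. F n m (v s) (g s)) has_real_derivative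
      ((n + 1) * (v s powr (n + 1) / v s) * v' * g s - v s powr (n + 1) * g') / (g s * g s)
      + m / (n - m + 1) * ((n - m + 1) / m * (g s powr ((n - m + 1) / m) / g s) * g')) (at s)"
    unfolding F_def using assms(3,4)
    by (intro DERIV_add DERIV_divide DERIV_cmult DERIV_powr_base assms(1,2)) auto
  have e1: "((n + 1) * (v s powr (n + 1) / v s) * v' * g s - v s powr (n + 1) * g') / (g s * g s)
      = (n + 1) * v s powr n / g s * v' - v s powr (n + 1) / (g s)\<^sup>2 * g'"
    unfolding v using assms(4) by (simp add: diff_divide_distrib power2_eq_square)
  have e2: "m / (n - m + 1) * ((n - m + 1) / m * (g s powr ((n - m + 1) / m) / g s) * g')
      = g s powr ((n + 1) / m - 2) * g'"
    unfolding g using c by (metis mult.assoc mult_1)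
  show ?thesis
    by (rule DERIV_cong[OF main], unfold e1 e2) (simp add: algebra_simps)
qed

section \<open>Hessian of the density and convexity\<close>

definition F_uu :: "real \<Rightarrow> real \<Rightarrow> real \<Rightarrow> real" where
  "F_uu n v g = n * (n + 1) * v powr n / (v * g)"

definition F_ug :: "real \<Rightarrow> real \<Rightarrow> real \<Rightarrow> real" where
  "F_ug n v g = - ((n + 1) * v powr n / g\<^sup>2)"

definition F_gg :: "real \<Rightarrow> real \<Rightarrow> real \<Rightarrow> real \<Rightarrow> real" where
  "F_gg n m v g = 2 * v powr n * v / g ^ 3 + ((n + 1) / m - 2) * g powr ((n + 1) / m - 2) / g"

definition F_hess :: "real \<Rightarrow> real \<Rightarrow> real \<Rightarrow> real \<Rightarrow> real" where
  "F_hess n m v g = F_uu n v g * F_gg n m v g - (F_ug n v g)\<^sup>2"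

text \<open>The contributions 2 n (n + 1) and -(n + 1)^2 to the first term combine to (n + 1) (n -
  1). In this form n > 1 fixes the sign of the first term and n + 1 > 2 m that of the second, which
  is the criterion for global convexity.\<close>

lemma F_hess_eq:
  assumes "0 < v" "0 < g"
  shows "F_hess n m v g = (n + 1) * (n - 1) * (v powr n)\<^sup>2 / g ^ 4
    + n * (n + 1) * ((n + 1) / m - 2) * v powr n * g powr ((n + 1) / m - 2) / (v * g\<^sup>2)"
proof -
  define P where "P = v powr n"
  define Q where "Q = g powr ((n + 1) / m - 2)"
  define k where "k = (n + 1) / m - 2"
  show ?thesis
    unfolding F_hess_def F_uu_def F_gg_def F_ug_def P_def[symmetric] Q_def[symmetric]
      k_def[symmetric]
    using assms by (simp add: field_simps power2_eq_square power3_eq_cube power4_eq_xxxx)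
qed

text \<open>Along a segment with direction (a, b) the second derivative is the Hessian form q, and
  completing the square gives A q = (A a + B b)^2 + (A C - B^2) b^2 for the Hessian entries A, B, C.
  Since A is positive for n > 0, the determinant decides the sign.\<close>

lemma convex_on_F:
  assumes "convex S" "S \<subseteq> {0<..} \<times> {0<..}" "n > 0" "m > 0" "n - m + 1 \<noteq> 0"
    and hess: "\<And>v g. (v, g) \<in> S \<Longrightarrow> 0 \<le> F_hess n m v g"
  shows "convex_on S (\<lambda>(v, g). F n m v g)"
proof (rule convex_onI[OF _ assms(1)])
  fix t :: real and x y :: "real \<times> real"
  assume t: "0 < t" "t < 1" and xy: "x \<in> S" "y \<in> S"
  obtain v g where x: "x = (v, g)" by fastforce
  obtain a b where ab: "y = (v + a, g + b)"
    by (metis add.commute diff_add_cancel surj_pair)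
  define V where "V s = v + s * a" for s
  define G where "G s = g + s * b" for s
  have VG: "(V s, G s) \<in> S" if "s \<in> {0..1}" for s
  proof -
    have "(1 - s) *\<^sub>R x + s *\<^sub>R y \<in> S"
      using convexD_alt[OF assms(1) xy] that by auto
    then show ?thesis by (simp add: x ab V_def G_def algebra_simps)
  qed
  have pos: "0 < V s" "0 < G s" if "s \<in> {0..1}" for s using VG[OF that] assms(2) by auto
  have dV: "(V has_real_derivative a) (at s)" and dG: "(G has_real_derivative b) (at s)" for s
    unfolding V_def G_def by (auto intro!: derivative_eq_intros)
  define D where "D s = (n + 1) * V s powr n / G s * a +
      (G s powr ((n + 1) / m - 2) - V s powr (n + 1) / (G s)\<^sup>2) * b" for s
  define D2 where "D2 s = F_uu n (V s) (G s) * a\<^sup>2 + 2 * F_ug n (V s) (G s) * a * b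
      + F_gg n m (V s) (G s) * b\<^sup>2" for s
  have d1: "((\<lambda>s. F n m (V s) (G s)) has_real_derivative D s) (at s)" if "s \<in> {0..1}" for s
    unfolding D_def by (rule DERIV_F[OF dV dG pos[OF that] assms(4,5)])
  have d2: "(D has_real_derivative D2 s) (at s)" if s: "s \<in> {0..1}" for s
  proof -
    define P where "P = V s powr n"
    define k where "k = (n + 1) / m - 2"
    define Q where "Q = G s powr k"
    have P1: "V s powr (n + 1) = P * V s" using pos[OF s] by (simp add: P_def powr_add)
    have h1: "((\<lambda>s. (G s)\<^sup>2) has_real_derivative 2 * G s * b) (at s)"
      using DERIV_power[OF dG, of 2 s] by (simp add: ac_simps)
    have h2: "((\<lambda>s. V s powr (n + 1)) has_real_derivative (n + 1) * (P * V s / V s) * a) (at s)"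
      using DERIV_powr_base[OF dV, of s "n + 1"] pos[OF s] unfolding P1 by simp
    have h3: "((\<lambda>s. V s powr n) has_real_derivative n * (P / V s) * a) (at s)"
      unfolding P_def by (rule DERIV_powr_base[OF dV pos(1)[OF s]])
    have h4: "((\<lambda>s. G s powr ((n + 1) / m - 2)) has_real_derivative k * (Q / G s) * b) (at s)"
      unfolding Q_def k_def by (rule DERIV_powr_base[OF dG pos(2)[OF s]])
    have "(D has_real_derivative
        (((n + 1) * (n * (P / V s) * a) * G s - (n + 1) * P * b) / (G s * G s)) * a
        + ((k * (Q / G s) * b)
          - ((n + 1) * (P * V s / V s) * a * (G s)\<^sup>2 - P * V s * (2 * G s * b)) / ((G s)\<^sup>2 * (G s)\<^sup>2)) * b)
        (at s)"
    proof -
      have "((\<lambda>s. (n + 1) * V s powr n / G s) has_real_derivative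
          ((n + 1) * (n * (P / V s) * a) * G s - (n + 1) * P * b) / (G s * G s)) (at s)"
        using DERIV_divide[OF DERIV_cmult[OF h3, of "n + 1"] dG] pos[OF s] unfolding P_def by simp
      moreover have "((\<lambda>s. V s powr (n + 1) / (G s)\<^sup>2) has_real_derivative
          ((n + 1) * (P * V s / V s) * a * (G s)\<^sup>2 - P * V s * (2 * G s * b)) / ((G s)\<^sup>2 * (G s)\<^sup>2)) (at s)"
        using DERIV_divide[OF h2 h1] pos[OF s] unfolding P1 by simp
      ultimately show ?thesis
        unfolding D_def by (intro DERIV_add DERIV_diff DERIV_cmult_right h4)
    qed
    moreover have "(((n + 1) * (n * (P / V s) * a) * G s - (n + 1) * P * b) / (G s * G s)) * a
        + ((k * (Q / G s) * b)
          - ((n + 1) * (P * V s / V s) * a * (G s)\<^sup>2 - P * V s * (2 * G s * b)) / ((G s)\<^sup>2 * (G s)\<^sup>2)) * b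
        = D2 s"
      unfolding D2_def F_uu_def F_ug_def F_gg_def P_def[symmetric] Q_def[symmetric] k_def[symmetric]
      using pos[OF s] by (simp add: field_simps power2_eq_square power3_eq_cube)
    ultimately show ?thesis by simp
  qed
  have D2: "0 \<le> D2 s" if s: "s \<in> {0..1}" for s
  proof -
    define A where "A = F_uu n (V s) (G s)"
    define B where "B = F_ug n (V s) (G s)"
    define C where "C = F_gg n m (V s) (G s)"
    have A: "0 < A" using pos[OF s] assms(3) by (simp add: A_def F_uu_def)
    have h: "0 \<le> A * C - B\<^sup>2" using hess[OF VG[OF s]] by (simp add: F_hess_def A_def B_def C_def)
    have "A * D2 s = (A * a + B * b)\<^sup>2 + (A * C - B\<^sup>2) * b\<^sup>2"
      unfolding D2_def A_def[symmetric] B_def[symmetric] C_def[symmetric]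
      by (simp add: algebra_simps power2_eq_square)
    then have "0 \<le> A * D2 s" using h by simp
    then show ?thesis using A by (simp add: zero_le_mult_iff)
  qed
  have "convex_on {0..1} (\<lambda>s. F n m (V s) (G s))"
    by (rule f''_ge0_imp_convex[OF _ d1 d2 D2]) auto
  from convex_onD[OF this, of t 0 1] t
  show "(case (1 - t) *\<^sub>R x + t *\<^sub>R y of (v, g) \<Rightarrow> F n m v g)
      \<le> (1 - t) * (case x of (v, g) \<Rightarrow> F n m v g) + t * (case y of (v, g) \<Rightarrow> F n m v g)"
    by (simp add: x ab V_def G_def algebra_simps)
qed

text \<open>At g = a^m the exponent of a becomes m ((n + 1) / m - 2) = n + 1 - 2 m, so with P = a^n
  both terms of \<open>F_hess_eq\<close> are multiples of P^2 / g^4. Their coefficients add up to (n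
  + 1) ((n - 1) + n ((n + 1) / m - 2)) = (n + 1)^2 (n - m) / m.\<close>

lemma F_hess_equilibrium_pos:
  assumes "n > m" "m > 0" "a > 0"
  shows "0 < F_hess n m a (a powr m)"
proof -
  define P where "P = a powr n"
  define g where "g = a powr m"
  have g: "0 < g" using assms by (simp add: g_def)
  have P: "0 < P" using assms by (simp add: P_def)
  have "m * ((n + 1) / m - 2) = n + 1 - m - m" using assms by (simp add: field_simps)
  then have "g powr ((n + 1) / m - 2) = a powr (n + 1 - m - m)"
    unfolding g_def by (simp add: powr_powr)
  also have "\<dots> = P * a / g\<^sup>2"
    using assms by (simp only: powr_diff powr_add P_def g_def) (simp add: power2_eq_square)
  finally have q: "g powr ((n + 1) / m - 2) = P * a / g\<^sup>2" .
  have "F_hess n m a g = P\<^sup>2 / g ^ 4 * ((n + 1)\<^sup>2 * (n - m) / m)"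
    unfolding F_hess_eq[OF assms(3) g] q P_def[symmetric]
    using assms g by (simp add: field_simps power2_eq_square power4_eq_xxxx)
  also have "\<dots> > 0" using assms g P by simp
  finally show ?thesis by (simp add: g_def)
qed

text \<open>The determinant is strictly positive at the equilibrium and continuous on the open
  quadrant, so it stays positive on a ball, and balls are convex.\<close>

lemma convex_on_F_near_equilibrium:
  assumes "n > m" "m > 0" "n - m + 1 \<noteq> 0" "a > 0"
  shows "\<exists>\<epsilon>>0. ball (a, a powr m) \<epsilon> \<subseteq> {0<..} \<times> {0<..} \<and>
    convex_on (ball (a, a powr m) \<epsilon>) (\<lambda>(v, g). F n m v g)"
proof -
  let ?p = "(a, a powr m)"
  let ?Q = "{0<..} \<times> {0<..} :: (real \<times> real) set"
  have oQ: "open ?Q" by (intro open_Times) auto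
  have "continuous_on ?Q (\<lambda>z. F_hess n m (fst z) (snd z))"
    unfolding F_hess_def F_uu_def F_ug_def F_gg_def
    by (auto intro!: continuous_intros)
  from continuous_open_preimage[OF this oQ, of "{0<..}"]
  have "open (?Q \<inter> (\<lambda>z. F_hess n m (fst z) (snd z)) -` {0<..})" by simp
  moreover have "?p \<in> ?Q \<inter> (\<lambda>z. F_hess n m (fst z) (snd z)) -` {0<..}"
    using F_hess_equilibrium_pos[OF assms(1,2,4)] assms(4) by simp
  ultimately obtain \<epsilon> where \<epsilon>: "\<epsilon> > 0"
    "ball ?p \<epsilon> \<subseteq> ?Q \<inter> (\<lambda>z. F_hess n m (fst z) (snd z)) -` {0<..}"
    using openE by blast
  have "convex_on (ball ?p \<epsilon>) (\<lambda>(v, g). F n m v g)"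
    by (rule convex_on_F) (use \<epsilon>(2) assms in \<open>auto intro: less_imp_le simp: subset_iff\<close>)
  then show ?thesis using \<epsilon> by blast
qed

lemma convex_on_F_global:
  assumes "n > 1" "n + 1 > 2 * m" "m > 0" "n - m + 1 \<noteq> 0"
  shows "convex_on ({0<..} \<times> {0<..}) (\<lambda>(v, g). F n m v g)"
proof (rule convex_on_F)
  have k: "0 \<le> (n + 1) / m - 2" using assms by (simp add: field_simps)
  show "0 \<le> F_hess n m v g" if "(v, g) \<in> {0<..} \<times> {0<..}" for v g
    using that assms(1) k by (subst F_hess_eq) (auto intro!: add_nonneg_nonneg mult_nonneg_nonneg divide_nonneg_nonneg)
qed (use assms in \<open>auto intro!: convex_Times\<close>)

section \<open>Dissipation along a solution\<close>

lemma Ck_ext_slice: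
  fixes g :: "'a::euclidean_space \<times> real \<Rightarrow> real"
  assumes "Ck_ext k (T \<times> I) (S \<times> I) g" "t \<in> I"
  shows "Ck_ext k T S (\<lambda>x. g (x, t))"
  unfolding Ck_ext_def
proof
  fix x assume "x \<in> T"
  then have "(x, t) \<in> T \<times> I" using assms(2) by simp
  from Ck_extE[OF assms(1) this] obtain U h where
    h: "open U" "(x, t) \<in> U" "Ck_on k U h" "\<And>y. y \<in> U \<Longrightarrow> y \<in> S \<times> I \<Longrightarrow> h y = g y" by metis
  have "open {x. (x, t) \<in> U}"
    using open_vimage[OF h(1), of "\<lambda>x. (x, t)"] by (simp add: vimage_def continuous_on_Pair)
  then show "\<exists>U h. open U \<and> x \<in> U \<and> Ck_on k U h \<and> (\<forall>y\<in>U \<inter> S. h y = g (y, t))"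
    using h Ck_on_slice[OF h(1,3)] assms(2)
    by (intro exI[of _ "{x. (x, t) \<in> U}"] exI[of _ "\<lambda>x. h (x, t)"]) auto
qed

text \<open>Regularity is established jointly in space and time and cut to fixed times afterwards:
  bounding the time derivative uniformly in \<open>x\<close> needs extensions in both
  variables.\<close>

theorem dissipation_identity:
  fixes \<Omega> :: "'a::euclidean_space set"
  assumes "open \<Omega>" "bounded \<Omega>" "smooth_boundary \<Omega>"
    and "m > 0" "n - m + 1 \<noteq> 0"
    and sol: "positive_smooth_solution n m \<Omega> u0 \<gamma>0 u \<gamma>"
    and "t > 0"
  defines "R \<equiv> \<lambda>x. 1 / (\<gamma> x t)\<^sup>2 *
      ((u x t powr m) powr ((n + 1) / m) - \<gamma> x t powr ((n + 1) / m)) * (u x t powr m - \<gamma> x t)"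
    and "w \<equiv> \<lambda>y. u y t powr n / \<gamma> y t"
  shows "set_integrable lborel \<Omega> (\<lambda>x. F n m (u x t) (\<gamma> x t))"
    and "set_integrable lborel \<Omega> (\<lambda>x. (norm (gradient w x))\<^sup>2)"
    and "set_integrable lborel \<Omega> R"
    and "((\<lambda>s. LINT x:\<Omega>|lborel. F n m (u x s) (\<gamma> x s)) has_real_derivative
      - ((n + 1) * (LINT x:\<Omega>|lborel. (norm (gradient w x))\<^sup>2) + (LINT x:\<Omega>|lborel. R x))) (at t)"
proof -
  let ?T = "closure \<Omega> \<times> {0<..} :: ('a \<times> real) set"
  have pos: "0 < u x s" "0 < \<gamma> x s" if "x \<in> closure \<Omega>" "0 < s" for x s
    using sol that unfolding positive_smooth_solution_def by blast+
  have ode: "((\<lambda>s. u x s) has_real_derivative laplacian (\<lambda>y. u y s powr n / \<gamma> y s) x) (at s)"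
    "((\<lambda>s. \<gamma> x s) has_real_derivative - \<gamma> x s + u x s powr m) (at s)" if "x \<in> \<Omega>" "0 < s" for x s
    using sol that unfolding positive_smooth_solution_def by blast+
  have uC: "Ck_ext k ?T ?T (\<lambda>z. u (fst z) (snd z))" and gC: "Ck_ext k ?T ?T (\<lambda>z. \<gamma> (fst z) (snd z))" for k
    using sol smooth_on_imp_Ck_ext[of ?T _ k] unfolding positive_smooth_solution_def
    by (auto simp: case_prod_beta')
  have FC: "Ck_ext k ?T ?T (\<lambda>z. F n m (u (fst z) (snd z)) (\<gamma> (fst z) (snd z)))" for k
    unfolding F_def
    by (intro Ck_ext_add Ck_ext_mult Ck_ext_const Ck_ext_divide Ck_ext_powr uC gC) (auto intro: pos)
  have slice: "Ck_ext k (closure \<Omega>) (closure \<Omega>) (\<lambda>x. f x s)"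
    if "Ck_ext k ?T ?T (\<lambda>z. f (fst z) (snd z))" "0 < s" for f k s
    using Ck_ext_slice[OF that(1), of s] that(2) by simp
  have sint: "set_integrable lborel \<Omega> (\<lambda>x. f x s)"
    if "Ck_ext k ?T ?T (\<lambda>z. f (fst z) (snd z))" "0 < s" for f k s
    by (rule Ck_ext_set_integrable[OF assms(1,2)
          Ck_ext_mono[OF slice[OF that] le_refl subset_refl closure_subset]])
  show "set_integrable lborel \<Omega> (\<lambda>x. F n m (u x t) (\<gamma> x t))"
    by (rule sint[OF FC[of 0] \<open>t > 0\<close>])
  let ?R = "\<lambda>x t. 1 / (\<gamma> x t)\<^sup>2 * ((u x t powr m) powr ((n + 1) / m)
    - \<gamma> x t powr ((n + 1) / m)) * (u x t powr m - \<gamma> x t)"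
  have sub: "Ck_ext k ?T ?T (\<lambda>z. f z - g z)" if "Ck_ext k ?T ?T f" "Ck_ext k ?T ?T g" for k f g
    using Ck_ext_add[OF that(1) Ck_ext_mult[OF Ck_ext_const[of k ?T ?T "- 1"] that(2)]] by simp
  have posT: "0 < u (fst z) (snd z)" "0 < u (fst z) (snd z) powr m" "0 < \<gamma> (fst z) (snd z)"
    "0 < \<gamma> (fst z) (snd z) * \<gamma> (fst z) (snd z)" if "z \<in> ?T" for z
    using pos[of "fst z" "snd z"] that by auto
  have "Ck_ext 0 ?T ?T (\<lambda>z. ?R (fst z) (snd z))"
    unfolding power2_eq_square
    by (intro sub Ck_ext_mult Ck_ext_const Ck_ext_divide Ck_ext_powr uC gC) (assumption | rule subset_refl posT)+
  from sint[OF this \<open>t > 0\<close>] show Rint: "set_integrable lborel \<Omega> R" unfolding R_def .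
  have "Ck_ext 2 ?T ?T (\<lambda>z. u (fst z) (snd z) powr n / \<gamma> (fst z) (snd z))"
    by (intro Ck_ext_divide Ck_ext_powr uC gC) (auto intro: pos)
  from slice[of 2 "\<lambda>x t. u x t powr n / \<gamma> x t", OF this \<open>t > 0\<close>]
  have wC: "Ck_ext 2 (closure \<Omega>) (closure \<Omega>) w" unfolding w_def .
  have "zero_normal_derivative \<Omega> w"
    unfolding w_def using sol \<open>t > 0\<close> pos
    by (intro zero_normal_derivative_powr_divide) (auto simp: positive_smooth_solution_def)
  note green = Neumann_Green_identity[OF assms(1-3) wC this]
  show "set_integrable lborel \<Omega> (\<lambda>x. (norm (gradient w x))\<^sup>2)" by (rule green(1))
  define \<Phi> where "\<Phi> z = F n m (u (fst z) (snd z)) (\<gamma> (fst z) (snd z))" for z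
  \<comment> \<open>Reading the time derivative as the derivative of \<open>\<Phi>\<close> in
    direction \<open>(0, 1)\<close> lets compactness bound it uniformly in \<open>x\<close> and in
    nearby times; the explicit formula is then used at time \<open>t\<close> alone.\<close>
  define f' where "f' x s = frechet_derivative \<Phi> (at (x, s)) (0, 1)" for x s
  let ?S = "\<Omega> \<times> {0<..} :: ('a \<times> real) set"
  have oS: "open ?S" using assms(1) by (intro open_Times) auto
  have \<Phi>C: "Ck_ext (Suc 0) ?T ?S \<Phi>"
    unfolding \<Phi>_def by (rule Ck_ext_mono[OF FC[of "Suc 0"]]) (use closure_subset in auto)
  have \<Phi>1: "Ck_on 1 ?S \<Phi>"
    unfolding One_nat_def by (rule Ck_ext_imp_Ck_on[OF oS _ \<Phi>C]) (use closure_subset in auto)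
  have der: "((\<lambda>s. F n m (u x s) (\<gamma> x s)) has_real_derivative f' x s) (at s)" if "x \<in> \<Omega>" "0 < s" for x s
    using has_real_derivative_line[OF \<Phi>1, of "(x, 0)" s "(0, 1)"] that by (simp add: \<Phi>_def f'_def)
  \<comment> \<open>The window from \<open>t / 2\<close> to \<open>2 * t\<close> surrounds
    \<open>t\<close> and stays away from time 0, where no smoothness is available.\<close>
  have "Ck_ext 0 (closure \<Omega> \<times> {t / 2..2 * t}) (\<Omega> \<times> {t / 2..2 * t}) (\<lambda>z. frechet_derivative \<Phi> (at z) (0, 1))"
    by (rule Ck_ext_mono[OF Ck_ext_partial[OF oS \<Phi>C]]) (use \<open>t > 0\<close> in auto)
  moreover have "compact (closure \<Omega> \<times> {t / 2..2 * t})"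
    using assms(2) by (intro compact_Times) auto
  moreover have "\<Omega> \<times> {t / 2..2 * t} \<subseteq> closure \<Omega> \<times> {t / 2..2 * t}" using closure_subset by auto
  ultimately obtain C where
    C: "\<And>z. z \<in> \<Omega> \<times> {t / 2..2 * t} \<Longrightarrow> \<bar>frechet_derivative \<Phi> (at z) (0, 1)\<bar> \<le> C"
    by (metis Ck_ext_bounded)
  \<comment> \<open>Since \<open>(u x t powr m) powr ((n + 1) / m)\<close> is
    \<open>u x t powr (n + 1)\<close>, the derivative of \<open>F\<close> in \<open>\<gamma>\<close>
    is minus the bracket of \<open>R\<close> divided by \<open>(\<gamma> x t)\<^sup>2\<close>; its
    product with the right-hand side for \<open>\<gamma>\<close> is \<open>- R x\<close>.\<close>
  have f't: "f' x t = (n + 1) * (w x * laplacian w x) - R x" if x: "x \<in> \<Omega>" for x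
  proof -
    have p: "0 < u x t" "0 < \<gamma> x t" using pos[of x t] x closure_subset \<open>t > 0\<close> by auto
    have "f' x t = (n + 1) * u x t powr n / \<gamma> x t * laplacian w x
        + (\<gamma> x t powr ((n + 1) / m - 2) - u x t powr (n + 1) / (\<gamma> x t)\<^sup>2) * (- \<gamma> x t + u x t powr m)"
      by (rule DERIV_unique[OF der[OF x \<open>t > 0\<close>]])
        (unfold w_def, rule DERIV_F[OF ode[OF x \<open>t > 0\<close>] p assms(4,5)])
    moreover have "\<gamma> x t powr ((n + 1) / m - 2) = \<gamma> x t powr ((n + 1) / m) / (\<gamma> x t)\<^sup>2"
      using p by (simp add: powr_diff)
    moreover have "(u x t powr m) powr ((n + 1) / m) = u x t powr (n + 1)"
      using assms(4) by (simp add: powr_powr)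
    ultimately show ?thesis using p by (simp add: R_def w_def field_simps)
  qed
  have int: "set_integrable lborel \<Omega> (\<lambda>x. (n + 1) * (w x * laplacian w x))"
    using green(2) by (rule set_integrable_mult_right)
  have val: "(LINT x:\<Omega>|lborel. f' x t)
      = - ((n + 1) * (LINT x:\<Omega>|lborel. (norm (gradient w x))\<^sup>2) + (LINT x:\<Omega>|lborel. R x))"
  proof -
    have "(LINT x:\<Omega>|lborel. f' x t) = (LINT x:\<Omega>|lborel. (n + 1) * (w x * laplacian w x) - R x)"
      by (rule set_lebesgue_integral_cong) (use assms(1) f't in auto)
    also have "\<dots> = (n + 1) * (LINT x:\<Omega>|lborel. w x * laplacian w x) - (LINT x:\<Omega>|lborel. R x)"
      using set_integral_diff(2)[OF int Rint] by simp
    finally show ?thesis by (simp add: green(3))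
  qed
  have "((\<lambda>s. LINT x:\<Omega>|lborel. F n m (u x s) (\<gamma> x s)) has_real_derivative (LINT x:\<Omega>|lborel. f' x t)) (at t)"
  proof (rule has_real_derivative_set_integral[OF assms(1,2), of "t / 2" t "2 * t"])
    show "set_integrable lborel \<Omega> (\<lambda>x. F n m (u x s) (\<gamma> x s))" if "t / 2 < s" for s
      using sint[OF FC[of 0]] that \<open>t > 0\<close> by simp
    have "Ck_ext 0 (closure \<Omega>) \<Omega> (\<lambda>x. frechet_derivative \<Phi> (at (x, t)) (0, 1))"
      by (rule Ck_ext_slice[OF Ck_ext_partial[OF oS \<Phi>C]]) (use \<open>t > 0\<close> in auto)
    then show "set_integrable lborel \<Omega> (\<lambda>x. f' x t)"
      unfolding f'_def by (rule Ck_ext_set_integrable[OF assms(1,2)])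
    show "\<bar>f' x s\<bar> \<le> C" if "x \<in> \<Omega>" "t / 2 < s" "s < 2 * t" for x s
      unfolding f'_def by (rule C) (use that in auto)
  qed (use \<open>t > 0\<close> der in auto)
  then show "((\<lambda>s. LINT x:\<Omega>|lborel. F n m (u x s) (\<gamma> x s)) has_real_derivative
      - ((n + 1) * (LINT x:\<Omega>|lborel. (norm (gradient w x))\<^sup>2) + (LINT x:\<Omega>|lborel. R x))) (at t)"
    unfolding val .
qed

text \<open>A non-integrable function has integral 0 by convention, and \<open>deriv\<close> is
  unspecified where there is no derivative. Integrability and differentiability are therefore part
  of the claim and give the identity its literal meaning.\<close>

theorem lemma4p1:
  fixes \<Omega> :: "(real ^ 'd) set"
    and u \<gamma> :: "real ^ 'd \<Rightarrow> real \<Rightarrow> real"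
    and u0 \<gamma>0 :: "real ^ 'd \<Rightarrow> real"
    and n m :: real
  assumes "open \<Omega>" and "bounded \<Omega>" and "smooth_boundary \<Omega>"
    and "n > 0" and "m > 0" and "n - m + 1 \<noteq> 0"
    and "bounded_measurable_on \<Omega> u0" and "bounded_measurable_on \<Omega> \<gamma>0"
    and "zero_normal_derivative \<Omega> u0" and "zero_normal_derivative \<Omega> \<gamma>0"
    and "positive_smooth_solution n m \<Omega> u0 \<gamma>0 u \<gamma>"
  shows
    "(\<forall>t>0.
        set_integrable lborel \<Omega> (\<lambda>x. F n m (u x t) (\<gamma> x t)) \<and>
        set_integrable lborel \<Omega> (\<lambda>x. (norm (gradient (\<lambda>y. u y t powr n / \<gamma> y t) x))\<^sup>2) \<and>
        set_integrable lborel \<Omega> (\<lambda>x. 1 / (\<gamma> x t)\<^sup>2 *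
          ((u x t powr m) powr ((n + 1) / m) - \<gamma> x t powr ((n + 1) / m)) * (u x t powr m - \<gamma> x t)) \<and>
        (\<lambda>s. LINT x:\<Omega>|lborel. F n m (u x s) (\<gamma> x s)) differentiable (at t) \<and>
        deriv (\<lambda>s. LINT x:\<Omega>|lborel. F n m (u x s) (\<gamma> x s)) t
          + (n + 1) * (LINT x:\<Omega>|lborel. (norm (gradient (\<lambda>y. u y t powr n / \<gamma> y t) x))\<^sup>2)
          + (LINT x:\<Omega>|lborel. 1 / (\<gamma> x t)\<^sup>2 *
              ((u x t powr m) powr ((n + 1) / m) - \<gamma> x t powr ((n + 1) / m)) * (u x t powr m - \<gamma> x t))
          = 0) \<and>
     (n > m \<longrightarrow>
        (\<forall>a>0. \<exists>\<epsilon>>0. ball (a, a powr m) \<epsilon> \<subseteq> {0<..} \<times> {0<..} \<and>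
          convex_on (ball (a, a powr m) \<epsilon>) (\<lambda>(v, g). F n m v g))) \<and>
     (n > 1 \<and> n + 1 > 2 * m \<longrightarrow>
        convex_on ({0<..} \<times> {0<..}) (\<lambda>(v, g). F n m v g))"
proof (intro conjI allI impI)
  fix t :: real assume "t > 0"
  note id = dissipation_identity[OF assms(1-3,5,6,11) this]
  let ?I = "\<lambda>s. LINT x:\<Omega>|lborel. F n m (u x s) (\<gamma> x s)"
  show "set_integrable lborel \<Omega> (\<lambda>x. F n m (u x t) (\<gamma> x t))" by (rule id(1))
  show "set_integrable lborel \<Omega> (\<lambda>x. (norm (gradient (\<lambda>y. u y t powr n / \<gamma> y t) x))\<^sup>2)" by (rule id(2))
  show "set_integrable lborel \<Omega> (\<lambda>x. 1 / (\<gamma> x t)\<^sup>2 *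
      ((u x t powr m) powr ((n + 1) / m) - \<gamma> x t powr ((n + 1) / m)) * (u x t powr m - \<gamma> x t))"
    by (rule id(3))
  show "?I differentiable (at t)" using id(4) real_differentiable_def by blast
  show "deriv ?I t
      + (n + 1) * (LINT x:\<Omega>|lborel. (norm (gradient (\<lambda>y. u y t powr n / \<gamma> y t) x))\<^sup>2)
      + (LINT x:\<Omega>|lborel. 1 / (\<gamma> x t)\<^sup>2 *
          ((u x t powr m) powr ((n + 1) / m) - \<gamma> x t powr ((n + 1) / m)) * (u x t powr m - \<gamma> x t)) = 0"
    using DERIV_imp_deriv[OF id(4)] by simp
qed (use assms(5,6) convex_on_F_near_equilibrium convex_on_F_global in blast)+

end
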